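(* Let $(M,L)$ be a pseudo-Finsler manifold with conic domain $A\subset TM\setminus\mathbf{0}$, let $V$ be an $L$-admissible vector field on an open subset $\Omega\subset M$, and let $R^V$ be the curvature tensor of $\nabla^V$. Then for all $X,Y,Z,W\in\mathfrak{X}(\Omega)$: (i) $R^V(X,Y)=-R^V(Y,X)$; (ii) $g_V(R^V(X,Y)Z,W)+g_V(R^V(X,Y)W,Z)=2B^V(X,Y,Z,W)$, where $$B^V(X,Y,Z,W)=(\nabla^V_YC_V)(\nabla^V_XV,Z,W)-(\nabla^V_XC_V)(\nabla^V_YV,Z,W)+C_V(R^V(Y,X)V,Z,W);$$ (iii) $R^V(X,Y)Z+R^V(Y,Z)X+R^V(Z,X)Y=0$. Furthermore, $$\begin{aligned}g_V(R^V(X,Y)Z,W)-g_V(R^V(Z,W)X,Y)=\;&B^V(Z,Y,X,W)+B^V(X,Z,Y,W)+B^V(W,X,Z,Y)\\&+B^V(Y,W,Z,X)+B^V(W,Z,X,Y)+B^V(X,Y,Z,W).\end{aligned}$$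
   Context: Let $M$ be a smooth manifold and $\pi:TM\to M$ its tangent bundle. An open subset $A\subset TM\setminus\mathbf{0}$ is conic if $\lambda v\in A$ for all $v\in A$, $\lambda>0$. A (two-homogeneous, conic) pseudo-Finsler metric is a smooth function $L:A\to\mathbb{R}$ with $L(\lambda v)=\lambda^2L(v)$ for all $v\in A$, $\lambda>0$, such that for every $v\in A$ the fundamental tensor $g_v(u,w)=\frac12\frac{\partial^2}{\partial t\,\partial s}L(v+tu+sw)|_{t=s=0}$, $u,w\in T_{\pi(v)}M$, is non-degenerate. $(M,L)$ is then called a pseudo-Finsler manifold. The Cartan tensor is $C_v(w_1,w_2,w_3)=\frac14\frac{\partial^3}{\partial s_3\partial s_2\partial s_1}L(v+\sum_{i=1}^3s_iw_i)|_{s_1=s_2=s_3=0}$. A vector field $V$ on an open set $\Omega\subset M$ is $L$-admissible if $V(x)\in A\cap T_xM$ for all $x\in\Omega$; $g_V$, $C_V$ are the tensors on $\Omega$ obtained by evaluating $g$, $C$ at $V$. $\nabla^V$ is the unique affine connection on $\Omega$ that is torsion-free and almost $g$-compatible, i.e. $\nabla^V_XY-\nabla^V_YX=[X,Y]$ and $X(g_V(Y,Z))=g_V(\nabla^V_XY,Z)+g_V(Y,\nabla^V_XZ)+2C_V(\nabla^V_XV,Y,Z)$ for all $X,Y,Z\in\mathfrak{X}(\Omega)$. Its curvature tensor is $R^V(X,Y)Z=\nabla^V_X\nabla^V_YZ-\nabla^V_Y\nabla^V_XZ-\nabla^V_{[X,Y]}Z$. The covariant derivative of the Cartan tensor is $$(\nabla^V_XC_V)(Y,Z,W)=X(C_V(Y,Z,W))-C_V(\nabla^V_XY,Z,W)-C_V(Y,\nabla^V_XZ,W)-C_V(Y,Z,\nabla^V_XW).$$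 *)

theory Defs
  imports "HOL-Analysis.Analysis" "HOL-Library.Function_Algebras"
begin

subsection \<open>Smooth maps between normed spaces\<close>

primrec Ck_on :: "nat \<Rightarrow> 'a::real_normed_vector set \<Rightarrow> ('a \<Rightarrow> 'b::real_normed_vector) \<Rightarrow> bool" where
  "Ck_on 0 S f \<longleftrightarrow> continuous_on S f"
| "Ck_on (Suc k) S f \<longleftrightarrow> (\<forall>x\<in>S. f differentiable at x) \<and>
     (\<forall>v. Ck_on k S (\<lambda>x. frechet_derivative f (at x) v))"

text \<open>Only used for open \<open>S\<close>.\<close>

definition smooth_on :: "'a::real_normed_vector set \<Rightarrow> ('a \<Rightarrow> 'b::real_normed_vector) \<Rightarrow> bool" where
  "smooth_on S f \<longleftrightarrow> (\<forall>k. Ck_on k S f)"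

subsection \<open>Manifolds\<close>

text \<open>
  The manifold is the whole type \<open>'m\<close>; the model space is \<open>'a\<close>. A chart is a pair of a domain
  and a coordinate map, whose values outside the domain are irrelevant. An atlas need not be
  maximal: it stands for the smooth structure that it generates.
\<close>

type_synonym ('m, 'a) chart = "'m set \<times> ('m \<Rightarrow> 'a)"

definition inv_chart :: "('m, 'a) chart \<Rightarrow> 'a \<Rightarrow> 'm" where
  "inv_chart c = inv_into (fst c) (snd c)"

definition smooth_atlas ::
    "('m::{t2_space,second_countable_topology}, 'a::euclidean_space) chart set \<Rightarrow> bool" where
  "smooth_atlas atl \<longleftrightarrow>
     (\<Union>c\<in>atl. fst c) = UNIV \<and>
     (\<forall>c\<in>atl. open (fst c) \<and> open (snd c ` fst c) \<and>
        homeomorphism (fst c) (snd c ` fst c) (snd c) (inv_chart c)) \<and>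
     (\<forall>c\<in>atl. \<forall>d\<in>atl. smooth_on (snd c ` (fst c \<inter> fst d)) (snd d \<circ> inv_chart c))"

definition smooth_function ::
    "('m, 'a::euclidean_space) chart set \<Rightarrow> 'm set \<Rightarrow> ('m \<Rightarrow> real) \<Rightarrow> bool" where
  "smooth_function atl \<Omega> f \<longleftrightarrow> (\<forall>c\<in>atl. smooth_on (snd c ` (fst c \<inter> \<Omega>)) (f \<circ> inv_chart c))"

subsection \<open>The tangent bundle\<close>

text \<open>
  A tangent vector at \<open>p\<close> is the family of its coordinate representations in all charts around
  \<open>p\<close>, subject to the transformation law; the entries for the other charts are set to zero, so
  that equal tangent vectors are equal functions. The vector space operations are pointwise.
\<close>

type_synonym ('m, 'a) tangent = "('m, 'a) chart \<Rightarrow> 'a"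

definition tangent_space ::
    "('m, 'a::euclidean_space) chart set \<Rightarrow> 'm \<Rightarrow> ('m, 'a) tangent set" where
  "tangent_space atl p =
     {v. (\<forall>c. \<not> (c \<in> atl \<and> p \<in> fst c) \<longrightarrow> v c = 0) \<and>
         (\<forall>c\<in>atl. \<forall>d\<in>atl. p \<in> fst c \<and> p \<in> fst d \<longrightarrow>
            v d = frechet_derivative (snd d \<circ> inv_chart c) (at (snd c p)) (v c))}"

definition tscale :: "real \<Rightarrow> ('m, 'a::real_vector) tangent \<Rightarrow> ('m, 'a) tangent" (infixr "*\<^sub>T" 75)
  where "r *\<^sub>T v = (\<lambda>c. r *\<^sub>R v c)"

definition tangent_bundle ::
    "('m, 'a::euclidean_space) chart set \<Rightarrow> ('m \<times> ('m, 'a) tangent) set" where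
  "tangent_bundle atl = {(p, v). v \<in> tangent_space atl p}"

text \<open>
  The inverse of the bundle chart induced by \<open>c\<close>: it sends \<open>(x, w)\<close> to the tangent vector at the
  point with coordinates \<open>x\<close> whose coordinate representation in \<open>c\<close> is \<open>w\<close>.
\<close>

definition inv_bundle_chart ::
    "('m, 'a::euclidean_space) chart set \<Rightarrow> ('m, 'a) chart \<Rightarrow> 'a \<times> 'a \<Rightarrow> 'm \<times> ('m, 'a) tangent" where
  "inv_bundle_chart atl c = (\<lambda>(x, w).
     (inv_chart c x,
      \<lambda>d. if d \<in> atl \<and> inv_chart c x \<in> fst d
          then frechet_derivative (snd d \<circ> inv_chart c) (at x) w else 0))"

definition bundle_chart_image ::
    "('m, 'a::euclidean_space) chart set \<Rightarrow> ('m \<times> ('m, 'a) tangent) set \<Rightarrow> ('m, 'a) chart \<Rightarrow> ('a \<times> 'a) set"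
  where "bundle_chart_image atl A c =
    {(x, w). x \<in> snd c ` fst c \<and> inv_bundle_chart atl c (x, w) \<in> A}"

subsection \<open>Pseudo-Finsler metrics\<close>

text \<open>The point of \<open>TM\<close> is the pair \<open>v\<close> of a base point and a tangent vector at it.\<close>

definition fundamental_tensor ::
    "('m \<times> ('m, 'a::euclidean_space) tangent \<Rightarrow> real) \<Rightarrow> 'm \<times> ('m, 'a) tangent \<Rightarrow>
     ('m, 'a) tangent \<Rightarrow> ('m, 'a) tangent \<Rightarrow> real" where
  "fundamental_tensor L v u w =
     1 / 2 * deriv (\<lambda>t. deriv (\<lambda>s. L (fst v, snd v + t *\<^sub>T u + s *\<^sub>T w)) 0) 0"

definition cartan_tensor ::
    "('m \<times> ('m, 'a::euclidean_space) tangent \<Rightarrow> real) \<Rightarrow> 'm \<times> ('m, 'a) tangent \<Rightarrow>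
     ('m, 'a) tangent \<Rightarrow> ('m, 'a) tangent \<Rightarrow> ('m, 'a) tangent \<Rightarrow> real" where
  "cartan_tensor L v w1 w2 w3 =
     1 / 4 * deriv (\<lambda>s3. deriv (\<lambda>s2. deriv (\<lambda>s1.
       L (fst v, snd v + s1 *\<^sub>T w1 + s2 *\<^sub>T w2 + s3 *\<^sub>T w3)) 0) 0) 0"

text \<open>Only the values of \<open>L\<close> on the conic domain \<open>A\<close> matter.\<close>

definition pseudo_finsler ::
    "('m, 'a::euclidean_space) chart set \<Rightarrow> ('m \<times> ('m, 'a) tangent) set \<Rightarrow>
     ('m \<times> ('m, 'a) tangent \<Rightarrow> real) \<Rightarrow> bool" where
  "pseudo_finsler atl A L \<longleftrightarrow>
     A \<subseteq> {(p, v) \<in> tangent_bundle atl. v \<noteq> 0} \<and>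
     (\<forall>c\<in>atl. open (bundle_chart_image atl A c)) \<and>
     (\<forall>p v. \<forall>r>0. (p, v) \<in> A \<longrightarrow> (p, r *\<^sub>T v) \<in> A) \<and>
     (\<forall>c\<in>atl. smooth_on (bundle_chart_image atl A c) (L \<circ> inv_bundle_chart atl c)) \<and>
     (\<forall>p v. \<forall>r>0. (p, v) \<in> A \<longrightarrow> L (p, r *\<^sub>T v) = r\<^sup>2 * L (p, v)) \<and>
     (\<forall>p v. (p, v) \<in> A \<longrightarrow>
        (\<forall>u\<in>tangent_space atl p.
           (\<forall>w\<in>tangent_space atl p. fundamental_tensor L (p, v) u w = 0) \<longrightarrow> u = 0))"

subsection \<open>Vector fields\<close>

type_synonym ('m, 'a) vfield = "'m \<Rightarrow> ('m, 'a) tangent"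

text \<open>
  Vector fields on \<open>\<Omega>\<close> are extended by zero outside \<open>\<Omega>\<close>, so that vector fields that agree on
  \<open>\<Omega>\<close> are equal; no regularity at the boundary of \<open>\<Omega>\<close> is implied.
\<close>

definition vector_fields ::
    "('m, 'a::euclidean_space) chart set \<Rightarrow> 'm set \<Rightarrow> ('m, 'a) vfield set" where
  "vector_fields atl \<Omega> =
     {X. (\<forall>p\<in>\<Omega>. X p \<in> tangent_space atl p) \<and> (\<forall>p. p \<notin> \<Omega> \<longrightarrow> X p = 0) \<and>
         (\<forall>c\<in>atl. smooth_on (snd c ` (fst c \<inter> \<Omega>)) (\<lambda>x. X (inv_chart c x) c))}"

definition fscale :: "('m \<Rightarrow> real) \<Rightarrow> ('m, 'a::real_vector) vfield \<Rightarrow> ('m, 'a) vfield"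
  (infixr "*\<^sub>F" 75) where
  "f *\<^sub>F X = (\<lambda>p. f p *\<^sub>T X p)"

text \<open>
  The derivative \<open>X f\<close>. Where \<open>f\<close> is differentiable, the value does not depend on the chart chosen
  around \<open>p\<close>, by the chain rule.
\<close>

definition vderiv ::
    "('m, 'a::euclidean_space) chart set \<Rightarrow> ('m, 'a) vfield \<Rightarrow> ('m \<Rightarrow> real) \<Rightarrow> 'm \<Rightarrow> real" where
  "vderiv atl X f p =
     (let c = (SOME c. c \<in> atl \<and> p \<in> fst c)
      in frechet_derivative (f \<circ> inv_chart c) (at (snd c p)) (X p c))"

text \<open>The coordinate expression \<open>[X, Y] = DY(X) - DX(Y)\<close>, i.e. \<open>[X, Y] f = X (Y f) - Y (X f)\<close>.\<close>

definition lie_bracket ::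
    "('m, 'a::euclidean_space) chart set \<Rightarrow> 'm set \<Rightarrow> ('m, 'a) vfield \<Rightarrow> ('m, 'a) vfield \<Rightarrow> ('m, 'a) vfield"
  where
  "lie_bracket atl \<Omega> X Y = (\<lambda>p c.
     if p \<in> \<Omega> \<and> c \<in> atl \<and> p \<in> fst c
     then frechet_derivative (\<lambda>x. Y (inv_chart c x) c) (at (snd c p)) (X p c)
        - frechet_derivative (\<lambda>x. X (inv_chart c x) c) (at (snd c p)) (Y p c)
     else 0)"

definition admissible ::
    "('m, 'a::euclidean_space) chart set \<Rightarrow> ('m \<times> ('m, 'a) tangent) set \<Rightarrow> 'm set \<Rightarrow> ('m, 'a) vfield \<Rightarrow> bool"
  where
  "admissible atl A \<Omega> V \<longleftrightarrow> V \<in> vector_fields atl \<Omega> \<and> (\<forall>p\<in>\<Omega>. (p, V p) \<in> A)"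

definition g_field ::
    "('m \<times> ('m, 'a::euclidean_space) tangent \<Rightarrow> real) \<Rightarrow> ('m, 'a) vfield \<Rightarrow>
     ('m, 'a) vfield \<Rightarrow> ('m, 'a) vfield \<Rightarrow> 'm \<Rightarrow> real" where
  "g_field L V Y Z = (\<lambda>p. fundamental_tensor L (p, V p) (Y p) (Z p))"

definition C_field ::
    "('m \<times> ('m, 'a::euclidean_space) tangent \<Rightarrow> real) \<Rightarrow> ('m, 'a) vfield \<Rightarrow>
     ('m, 'a) vfield \<Rightarrow> ('m, 'a) vfield \<Rightarrow> ('m, 'a) vfield \<Rightarrow> 'm \<Rightarrow> real" where
  "C_field L V Y Z W = (\<lambda>p. cartan_tensor L (p, V p) (Y p) (Z p) (W p))"

subsection \<open>Connections\<close>

definition affine_connection ::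
    "('m, 'a::euclidean_space) chart set \<Rightarrow> 'm set \<Rightarrow>
     (('m, 'a) vfield \<Rightarrow> ('m, 'a) vfield \<Rightarrow> ('m, 'a) vfield) \<Rightarrow> bool" where
  "affine_connection atl \<Omega> nabla \<longleftrightarrow>
     (\<forall>X\<in>vector_fields atl \<Omega>. \<forall>Y\<in>vector_fields atl \<Omega>. nabla X Y \<in> vector_fields atl \<Omega>) \<and>
     (\<forall>X\<in>vector_fields atl \<Omega>. \<forall>X'\<in>vector_fields atl \<Omega>. \<forall>Y\<in>vector_fields atl \<Omega>.
        nabla (X + X') Y = nabla X Y + nabla X' Y) \<and>
     (\<forall>X\<in>vector_fields atl \<Omega>. \<forall>Y\<in>vector_fields atl \<Omega>. \<forall>Y'\<in>vector_fields atl \<Omega>.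
        nabla X (Y + Y') = nabla X Y + nabla X Y') \<and>
     (\<forall>f. smooth_function atl \<Omega> f \<longrightarrow>
        (\<forall>X\<in>vector_fields atl \<Omega>. \<forall>Y\<in>vector_fields atl \<Omega>.
           nabla (f *\<^sub>F X) Y = f *\<^sub>F nabla X Y \<and>
           nabla X (f *\<^sub>F Y) = vderiv atl X f *\<^sub>F Y + f *\<^sub>F nabla X Y))"

text \<open>
  The defining property of the connection \<open>\<nabla>\<^sup>V\<close>, which determines its values on vector fields on
  \<open>\<Omega>\<close>.
\<close>

definition is_nabla_V ::
    "('m, 'a::euclidean_space) chart set \<Rightarrow> ('m \<times> ('m, 'a) tangent \<Rightarrow> real) \<Rightarrow> 'm set \<Rightarrow>
     ('m, 'a) vfield \<Rightarrow> (('m, 'a) vfield \<Rightarrow> ('m, 'a) vfield \<Rightarrow> ('m, 'a) vfield) \<Rightarrow> bool" where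
  "is_nabla_V atl L \<Omega> V nabla \<longleftrightarrow>
     affine_connection atl \<Omega> nabla \<and>
     (\<forall>X\<in>vector_fields atl \<Omega>. \<forall>Y\<in>vector_fields atl \<Omega>.
        nabla X Y - nabla Y X = lie_bracket atl \<Omega> X Y) \<and>
     (\<forall>X\<in>vector_fields atl \<Omega>. \<forall>Y\<in>vector_fields atl \<Omega>. \<forall>Z\<in>vector_fields atl \<Omega>. \<forall>p\<in>\<Omega>.
        vderiv atl X (g_field L V Y Z) p =
          g_field L V (nabla X Y) Z p + g_field L V Y (nabla X Z) p
          + 2 * C_field L V (nabla X V) Y Z p)"

definition curvature ::
    "('m, 'a::euclidean_space) chart set \<Rightarrow> 'm set \<Rightarrow>
     (('m, 'a) vfield \<Rightarrow> ('m, 'a) vfield \<Rightarrow> ('m, 'a) vfield) \<Rightarrow>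
     ('m, 'a) vfield \<Rightarrow> ('m, 'a) vfield \<Rightarrow> ('m, 'a) vfield \<Rightarrow> ('m, 'a) vfield" where
  "curvature atl \<Omega> nabla X Y Z =
     nabla X (nabla Y Z) - nabla Y (nabla X Z) - nabla (lie_bracket atl \<Omega> X Y) Z"

text \<open>\<open>nabla_C \<dots> X Y Z W\<close> is \<open>(\<nabla>\<^sub>X C\<^sub>V)(Y, Z, W)\<close>.\<close>

definition nabla_C ::
    "('m, 'a::euclidean_space) chart set \<Rightarrow> ('m \<times> ('m, 'a) tangent \<Rightarrow> real) \<Rightarrow> ('m, 'a) vfield \<Rightarrow>
     (('m, 'a) vfield \<Rightarrow> ('m, 'a) vfield \<Rightarrow> ('m, 'a) vfield) \<Rightarrow>
     ('m, 'a) vfield \<Rightarrow> ('m, 'a) vfield \<Rightarrow> ('m, 'a) vfield \<Rightarrow> ('m, 'a) vfield \<Rightarrow> 'm \<Rightarrow> real" where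
  "nabla_C atl L V nabla X Y Z W = (\<lambda>p.
     vderiv atl X (C_field L V Y Z W) p
     - C_field L V (nabla X Y) Z W p
     - C_field L V Y (nabla X Z) W p
     - C_field L V Y Z (nabla X W) p)"

definition B_field ::
    "('m, 'a::euclidean_space) chart set \<Rightarrow> ('m \<times> ('m, 'a) tangent \<Rightarrow> real) \<Rightarrow> 'm set \<Rightarrow>
     ('m, 'a) vfield \<Rightarrow> (('m, 'a) vfield \<Rightarrow> ('m, 'a) vfield \<Rightarrow> ('m, 'a) vfield) \<Rightarrow>
     ('m, 'a) vfield \<Rightarrow> ('m, 'a) vfield \<Rightarrow> ('m, 'a) vfield \<Rightarrow> ('m, 'a) vfield \<Rightarrow> 'm \<Rightarrow> real" where
  "B_field atl L \<Omega> V nabla X Y Z W = (\<lambda>p.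
     nabla_C atl L V nabla Y (nabla X V) Z W p
     - nabla_C atl L V nabla X (nabla Y V) Z W p
     + C_field L V (curvature atl \<Omega> nabla Y X V) Z W p)"

end

theory Submission
  imports Defs
begin

text \<open>
  Antisymmetry is formal, and torsion-freeness reduces the first Bianchi identity to the Jacobi
  identity for the Lie bracket, which holds chart by chart because second derivatives commute.
  For (ii), evaluate \<open>X (Y f) - Y (X f) - [X, Y] f = 0\<close> at \<open>f = g\<^sub>V(Z, W)\<close> by almost
  compatibility: the second-order terms assemble into the curvature, the mixed first-order terms
  cancel, and the derivatives of \<open>C\<^sub>V(\<nabla>\<^sub>XV, Z, W)\<close> and \<open>C\<^sub>V(\<nabla>\<^sub>YV, Z, W)\<close> produce \<open>B\<^sup>V\<close>. The last
  identity is linear algebra from the other three. The analytic input is that \<open>g\<^sub>V\<close> and \<open>C\<^sub>V\<close> are,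
  in coordinates, iterated vertical derivatives of a smooth function.
\<close>

section \<open>Calculus of smooth maps\<close>

text \<open>\<open>Ck_on\<close> differentiates in fixed directions, but every object of the theorem
  differentiates in a direction that moves with the point: \<open>X p c\<close> on the base,
  \<open>(0, X p c)\<close> in the fibre. Such a direction is expanded in \<open>Basis\<close>,
  which requires linearity in it. The outermost direction is linear because a Frechet derivative is;
  an inner one is shown to be so by commuting the derivatives. This is why symmetry of second
  derivatives is used well beyond the Jacobi identity.

  For the pair identity, take the cyclic identities of (X,Y,Z) and (Y,Z,W) with a plus sign and
  those of (Z,W,X) and (W,X,Y) with a minus sign, the missing field being paired by
  \<open>g\<close>. Antisymmetry in the first two slots and (ii) in the last two turn this into
  twice the left-hand side against six terms 2B, hence the coefficients 1.\<close>

abbreviation dir_deriv :: "'a \<Rightarrow> ('a::real_normed_vector \<Rightarrow> 'b::real_normed_vector) \<Rightarrow> 'a \<Rightarrow> 'b" where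
  "dir_deriv v f \<equiv> (\<lambda>x. frechet_derivative f (at x) v)"

lemma dir_deriv_eq: "(f has_derivative f') (at x) \<Longrightarrow> frechet_derivative f (at x) = f'"
  by (metis frechet_derivative_at)

text \<open>\<open>frechet_derivative\<close> is a choice among all derivatives at \<open>x\<close>.
  Maps that agree near \<open>x\<close> have the same derivatives, hence the same choice, even where
  none exists; so differentiability is not assumed.\<close>

lemma dir_deriv_cong:
  assumes "open S" "x \<in> S" "\<And>y. y \<in> S \<Longrightarrow> f y = g y"
  shows "frechet_derivative f (at x) = frechet_derivative g (at x)"
proof -
  have "(f has_derivative D) (at x) \<longleftrightarrow> (g has_derivative D) (at x)" for D
    using has_derivative_transform_within_open[OF _ assms(1,2), of f D UNIV g]
      has_derivative_transform_within_open[OF _ assms(1,2), of g D UNIV f] assms(3) by auto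
  then show ?thesis
    unfolding frechet_derivative_def by simp
qed

lemma differentiable_cong:
  assumes "open S" "x \<in> S" "\<And>y. y \<in> S \<Longrightarrow> f y = g y" "f differentiable at x"
  shows "g differentiable at x"
proof -
  obtain D where "(f has_derivative D) (at x)" using assms(4) by (auto simp: differentiable_def)
  then have "(g has_derivative D) (at x)"
    using has_derivative_transform_within_open[OF _ assms(1,2)] assms(3) by blast
  then show ?thesis by (auto simp: differentiable_def)
qed

lemma frechet_derivative_linear:
  assumes "f differentiable at x"
  shows "linear (frechet_derivative f (at x))"
  using assms by (simp add: linear_frechet_derivative)

section \<open>The classes \<open>Ck_on\<close> and their closure properties\<close>

lemma Ck_on_cong:
  assumes "open S" "\<And>x. x \<in> S \<Longrightarrow> f x = g x" "Ck_on k S f"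
  shows "Ck_on k S g"
  using assms
proof (induction k arbitrary: f g)
  case 0
  then show ?case using continuous_on_cong[of S S f g] by simp
next
  case (Suc k)
  have "Ck_on k S (dir_deriv v g)" for v
    by (rule Suc.IH[OF Suc.prems(1) fun_cong[OF dir_deriv_cong[OF Suc.prems(1) _ Suc.prems(2)]]])
      (use Suc.prems(3) in simp_all)
  moreover have "g differentiable at x" if "x \<in> S" for x
    by (rule differentiable_cong[OF Suc.prems(1) that Suc.prems(2)]) (use Suc.prems(3) that in simp_all)
  ultimately show ?case by simp
qed

text \<open>Lets the closure proofs quote a derivative rule in explicit form:
  \<open>dir_deriv v f\<close> is known to equal \<open>D x v\<close> only on \<open>S\<close>, and
  \<open>Ck_on_cong\<close> absorbs the difference outside.\<close>

lemma Ck_on_SucI: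
  assumes "open S" and d: "\<And>x. x \<in> S \<Longrightarrow> (f has_derivative D x) (at x)"
    and "\<And>v. Ck_on k S (\<lambda>x. D x v)"
  shows "Ck_on (Suc k) S f"
proof -
  have "f differentiable at x" if "x \<in> S" for x
    using d[OF that] unfolding differentiable_def by blast
  moreover have "Ck_on k S (dir_deriv v f)" for v
    by (rule Ck_on_cong[OF assms(1) _ assms(3)[of v]]) (simp add: dir_deriv_eq[OF d])
  ultimately show ?thesis by simp
qed

lemma Ck_on_differentiable: "Ck_on (Suc k) S f \<Longrightarrow> x \<in> S \<Longrightarrow> f differentiable at x"
  by simp

lemma Ck_on_has_derivative:
  "Ck_on (Suc k) S f \<Longrightarrow> x \<in> S \<Longrightarrow> (f has_derivative frechet_derivative f (at x)) (at x)"
  using Ck_on_differentiable frechet_derivative_works by blast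

lemma Ck_on_dir_deriv: "Ck_on (Suc k) S f \<Longrightarrow> Ck_on k S (dir_deriv v f)"
  by simp

text \<open>In the product and chain rules one factor stays undifferentiated; this brings it down to
  the class \<open>k\<close> of the induction hypothesis.\<close>

lemma Ck_on_pred: "Ck_on (Suc k) S f \<Longrightarrow> Ck_on k S f"
proof (induction k arbitrary: f)
  case 0
  then show ?case
    by (auto intro!: continuous_at_imp_continuous_on differentiable_imp_continuous_within)
next
  case (Suc k)
  then show ?case by (metis Ck_on.simps(2))
qed

lemma Ck_on_bounded_linear_compose:
  assumes "open S" "bounded_linear h" "Ck_on k S f"
  shows "Ck_on k S (\<lambda>x. h (f x))"
  using assms(3)
proof (induction k arbitrary: f)
  case 0
  then show ?case using assms(2) by (simp add: bounded_linear.continuous_on)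
next
  case (Suc k)
  show ?case
    by (rule Ck_on_SucI[OF assms(1) bounded_linear.has_derivative[OF assms(2) Ck_on_has_derivative[OF Suc.prems]]
          Suc.IH[OF Ck_on_dir_deriv[OF Suc.prems]]])
qed

lemma Ck_on_add:
  assumes "open S" "Ck_on k S f" "Ck_on k S g"
  shows "Ck_on k S (\<lambda>x. f x + g x)"
  using assms(2,3)
proof (induction k arbitrary: f g)
  case 0
  then show ?case by (simp add: continuous_on_add)
next
  case (Suc k)
  show ?case
    by (rule Ck_on_SucI[OF assms(1) has_derivative_add[OF Ck_on_has_derivative[OF Suc.prems(1)]
            Ck_on_has_derivative[OF Suc.prems(2)]]
          Suc.IH[OF Ck_on_dir_deriv[OF Suc.prems(1)] Ck_on_dir_deriv[OF Suc.prems(2)]]])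
qed

lemma Ck_on_const: "Ck_on k S (\<lambda>x. c)"
proof (induction k arbitrary: c)
  case (Suc k)
  then show ?case by simp
qed simp

lemma Ck_on_sum:
  assumes "open S" "\<And>i. i \<in> I \<Longrightarrow> Ck_on k S (f i)"
  shows "Ck_on k S (\<lambda>x. \<Sum>i\<in>I. f i x)"
  using assms(2)
proof (induction I rule: infinite_finite_induct)
  case (insert i I)
  then show ?case using Ck_on_add[OF assms(1), of k "f i" "\<lambda>x. \<Sum>i\<in>I. f i x"] by simp
qed (simp_all add: Ck_on_const)

lemma (in bounded_bilinear) Ck_on_prod:
  assumes "open S" "Ck_on k S f" "Ck_on k S g"
  shows "Ck_on k S (\<lambda>x. prod (f x) (g x))"
  using assms(2,3)
proof (induction k arbitrary: f g)
  case 0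
  then show ?case by (simp add: continuous_on)
next
  case (Suc k)
  show ?case
  proof (rule Ck_on_SucI[OF assms(1) FDERIV[OF Ck_on_has_derivative[OF Suc.prems(1)]
            Ck_on_has_derivative[OF Suc.prems(2)]]])
    fix v
    show "Ck_on k S (\<lambda>x. prod (f x) (dir_deriv v g x) + prod (dir_deriv v f x) (g x))"
      by (rule Ck_on_add[OF assms(1)
            Suc.IH[OF Ck_on_pred[OF Suc.prems(1)] Ck_on_dir_deriv[OF Suc.prems(2)]]
            Suc.IH[OF Ck_on_dir_deriv[OF Suc.prems(1)] Ck_on_pred[OF Suc.prems(2)]]])
  qed
qed

text \<open>Trades a direction that varies with the point for finitely many fixed ones, at the price
  of scalar coefficients.\<close>

lemma linear_basis_expansion:
  fixes h :: "'a::euclidean_space \<Rightarrow> 'b::real_normed_vector"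
  assumes "linear h"
  shows "h w = (\<Sum>b\<in>Basis. (w \<bullet> b) *\<^sub>R h b)"
proof -
  have "h w = h (\<Sum>b\<in>Basis. (w \<bullet> b) *\<^sub>R b)" by (simp add: euclidean_representation)
  then show ?thesis by (simp add: linear_sum[OF assms] linear_scale[OF assms])
qed

text \<open>The chain rule applies a varying linear map to a varying vector. Expanded in
  \<open>Basis\<close>, this is a finite sum of products of a coordinate of the derivative of
  \<open>g\<close> and a fixed-direction derivative of \<open>f\<close> along \<open>g\<close>, to
  which the induction hypothesis applies.\<close>

lemma Ck_on_compose:
  fixes g :: "'a::real_normed_vector \<Rightarrow> 'b::euclidean_space" and f :: "'b \<Rightarrow> 'c::real_normed_vector"
  assumes "open S" "Ck_on k T f" "Ck_on k S g" "g ` S \<subseteq> T"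
  shows "Ck_on k S (\<lambda>x. f (g x))"
  using assms(2,3)
proof (induction k arbitrary: f)
  case 0
  then show ?case using continuous_on_compose2[of T f S g] assms(4) by simp
next
  case (Suc k)
  have T: "g x \<in> T" if "x \<in> S" for x using that assms(4) by blast
  show ?case
  proof (rule Ck_on_SucI[OF assms(1) has_derivative_compose[OF Ck_on_has_derivative[OF Suc.prems(2)]
            Ck_on_has_derivative[OF Suc.prems(1) T]]])
    fix v
    have e: "(\<Sum>b\<in>Basis. (dir_deriv v g x \<bullet> b) *\<^sub>R dir_deriv b f (g x))
      = frechet_derivative f (at (g x)) (dir_deriv v g x)" if "x \<in> S" for x
      using frechet_derivative_linear[OF Ck_on_differentiable[OF Suc.prems(1) T[OF that]]]
      by (rule linear_basis_expansion[symmetric])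
    have "Ck_on k S (\<lambda>x. \<Sum>b\<in>Basis. (dir_deriv v g x \<bullet> b) *\<^sub>R dir_deriv b f (g x))"
      by (rule Ck_on_sum[OF assms(1) bounded_bilinear.Ck_on_prod[OF bounded_bilinear_scaleR assms(1)
            Ck_on_bounded_linear_compose[OF assms(1) bounded_linear_inner_left Ck_on_dir_deriv[OF Suc.prems(2)]]
            Suc.IH[OF Ck_on_dir_deriv[OF Suc.prems(1)] Ck_on_pred[OF Suc.prems(2)]]]])
    then show "Ck_on k S (\<lambda>x. frechet_derivative f (at (g x)) (dir_deriv v g x))"
      by (rule Ck_on_cong[OF assms(1), rotated]) (rule e)
  qed
qed

section \<open>Closure properties of smooth maps\<close>

lemma smooth_on_cong:
  "open S \<Longrightarrow> (\<And>x. x \<in> S \<Longrightarrow> f x = g x) \<Longrightarrow> smooth_on S f \<Longrightarrow> smooth_on S g"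
  unfolding smooth_on_def using Ck_on_cong by blast

lemma smooth_on_differentiable: "smooth_on S f \<Longrightarrow> x \<in> S \<Longrightarrow> f differentiable at x"
  unfolding smooth_on_def by (meson Ck_on_differentiable)

lemma smooth_on_has_derivative:
  "smooth_on S f \<Longrightarrow> x \<in> S \<Longrightarrow> (f has_derivative frechet_derivative f (at x)) (at x)"
  using smooth_on_differentiable frechet_derivative_works by blast

lemma smooth_on_linear: "smooth_on S f \<Longrightarrow> x \<in> S \<Longrightarrow> linear (frechet_derivative f (at x))"
  using smooth_on_differentiable frechet_derivative_linear by blast

lemma smooth_on_dir_deriv: "smooth_on S f \<Longrightarrow> smooth_on S (dir_deriv v f)"
  unfolding smooth_on_def by (blast intro: Ck_on_dir_deriv)

lemma smooth_on_add:
  "open S \<Longrightarrow> smooth_on S f \<Longrightarrow> smooth_on S g \<Longrightarrow> smooth_on S (\<lambda>x. f x + g x)"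
  unfolding smooth_on_def using Ck_on_add by blast

lemma smooth_on_sum:
  "open S \<Longrightarrow> (\<And>i. i \<in> I \<Longrightarrow> smooth_on S (f i)) \<Longrightarrow> smooth_on S (\<lambda>x. \<Sum>i\<in>I. f i x)"
  unfolding smooth_on_def by (simp add: Ck_on_sum)

lemma smooth_on_const: "smooth_on S (\<lambda>x. c)"
  unfolding smooth_on_def using Ck_on_const by blast

lemma smooth_on_bounded_linear_compose:
  "open S \<Longrightarrow> bounded_linear h \<Longrightarrow> smooth_on S f \<Longrightarrow> smooth_on S (\<lambda>x. h (f x))"
  unfolding smooth_on_def using Ck_on_bounded_linear_compose by blast

lemma smooth_on_scaleR:
  "open S \<Longrightarrow> smooth_on S f \<Longrightarrow> smooth_on S g \<Longrightarrow> smooth_on S (\<lambda>x. f x *\<^sub>R g x)"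
  unfolding smooth_on_def using bounded_bilinear.Ck_on_prod[OF bounded_bilinear_scaleR] by blast

lemma smooth_on_minus:
  "open S \<Longrightarrow> smooth_on S f \<Longrightarrow> smooth_on S (\<lambda>x. - f x)"
  using smooth_on_bounded_linear_compose[OF _ bounded_linear_minus[OF bounded_linear_ident]] .

lemma smooth_on_compose:
  fixes g :: "'a::real_normed_vector \<Rightarrow> 'b::euclidean_space"
  shows "open S \<Longrightarrow> smooth_on T f \<Longrightarrow> smooth_on S g \<Longrightarrow> g ` S \<subseteq> T \<Longrightarrow> smooth_on S (\<lambda>x. f (g x))"
  unfolding smooth_on_def using Ck_on_compose by blast

lemma smooth_on_ident:
  fixes S :: "'a::real_normed_vector set"
  shows "smooth_on S (\<lambda>x. x)"
proof -
  have "Ck_on k S (\<lambda>x. x)" for k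
    by (cases k) (simp_all add: Ck_on_const)
  then show ?thesis by (simp add: smooth_on_def)
qed

lemma smooth_on_Pair:
  assumes "open S" "smooth_on S f" "smooth_on S g"
  shows "smooth_on S (\<lambda>x. (f x, g x))"
proof -
  have "smooth_on S (\<lambda>x. (f x, 0) + (0, g x))"
    using assms
    by (intro smooth_on_add smooth_on_bounded_linear_compose[of S "\<lambda>y. (y, 0)"]
        smooth_on_bounded_linear_compose[of S "\<lambda>y. (0, y)"])
      (auto intro: bounded_linear_Pair bounded_linear_ident bounded_linear_zero)
  then show ?thesis by simp
qed

section \<open>Symmetry of second derivatives\<close>

lemma second_difference_mvt:
  fixes f :: "'a::real_normed_vector \<Rightarrow> real"
  assumes "Ck_on (Suc (Suc 0)) S f" and "h > 0"
    and in_S: "\<And>s t. 0 \<le> s \<Longrightarrow> s \<le> h \<Longrightarrow> 0 \<le> t \<Longrightarrow> t \<le> h \<Longrightarrow> x + s *\<^sub>R a + t *\<^sub>R b \<in> S"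
  shows "\<exists>s t. 0 < s \<and> s < h \<and> 0 < t \<and> t < h \<and>
    f (x + h *\<^sub>R a + h *\<^sub>R b) - f (x + h *\<^sub>R a) - f (x + h *\<^sub>R b) + f x
      = h * (h * dir_deriv b (dir_deriv a f) (x + s *\<^sub>R a + t *\<^sub>R b))"
proof -
  have line: "((\<lambda>t. F (z t)) has_real_derivative dir_deriv v F (z t)) (at t)"
    if "F differentiable at (z t)" "z = (\<lambda>t. y + t *\<^sub>R v)"
    for F :: "'a \<Rightarrow> real" and t v y z
  proof -
    have "((\<lambda>t. F (z t)) has_derivative (\<lambda>r. frechet_derivative F (at (z t)) (r *\<^sub>R v))) (at t)"
      using that(1) unfolding that(2)
      by (intro has_derivative_compose[of "\<lambda>t. y + t *\<^sub>R v" _ t UNIV F])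
        (auto simp: frechet_derivative_works[symmetric] intro!: derivative_eq_intros)
    moreover have "(\<lambda>r. frechet_derivative F (at (z t)) (r *\<^sub>R v)) = (*) (dir_deriv v F (z t))"
      using linear_scale[OF frechet_derivative_linear[OF that(1)]] by auto
    ultimately show ?thesis by (simp add: has_field_derivative_def)
  qed
  have fd: "f differentiable at y" "dir_deriv v f differentiable at y" if "y \<in> S" for y v
    using assms(1) that by auto
  \<comment> \<open>The second difference is the increment of \<open>\<phi>\<close> over
    \<open>[0, h]\<close>, and \<open>\<phi>'\<close> is in turn an increment of
    \<open>dir_deriv a f\<close> in direction \<open>b\<close>: one mean value theorem for each
    direction. The second difference is symmetric in \<open>a\<close> and \<open>b\<close>, so it
    can be read in either order of differentiation.\<close>
  define \<phi> where "\<phi> = (\<lambda>s. f ((x + h *\<^sub>R b) + s *\<^sub>R a) - f (x + s *\<^sub>R a))"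
  define \<phi>' where "\<phi>' = (\<lambda>s. dir_deriv a f ((x + h *\<^sub>R b) + s *\<^sub>R a) - dir_deriv a f (x + s *\<^sub>R a))"
  have "(\<phi> has_real_derivative \<phi>' s) (at s)" if "0 \<le> s" "s \<le> h" for s
    unfolding \<phi>_def \<phi>'_def using in_S[of s h] in_S[of s 0] that \<open>h > 0\<close>
    by (intro DERIV_diff line fd) (auto simp: algebra_simps)
  then obtain s where s: "0 < s" "s < h" "\<phi> h - \<phi> 0 = (h - 0) * \<phi>' s"
    using MVT2[of 0 h \<phi> \<phi>'] \<open>h > 0\<close> by auto
  define \<psi> where "\<psi> = (\<lambda>t. dir_deriv a f ((x + s *\<^sub>R a) + t *\<^sub>R b))"
  have "(\<psi> has_real_derivative dir_deriv b (dir_deriv a f) ((x + s *\<^sub>R a) + t *\<^sub>R b)) (at t)"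
    if "0 \<le> t" "t \<le> h" for t
    unfolding \<psi>_def using in_S[of s t] that s by (intro line fd) auto
  then obtain t where t: "0 < t" "t < h"
    "\<psi> h - \<psi> 0 = (h - 0) * dir_deriv b (dir_deriv a f) ((x + s *\<^sub>R a) + t *\<^sub>R b)"
    using MVT2[of 0 h \<psi> "\<lambda>t. dir_deriv b (dir_deriv a f) ((x + s *\<^sub>R a) + t *\<^sub>R b)"] \<open>h > 0\<close> by auto
  have "\<phi>' s = \<psi> h - \<psi> 0"
    by (simp add: \<phi>'_def \<psi>_def algebra_simps)
  moreover have "\<phi> h - \<phi> 0 = f (x + h *\<^sub>R a + h *\<^sub>R b) - f (x + h *\<^sub>R a) - f (x + h *\<^sub>R b) + f x"
    by (simp add: \<phi>_def algebra_simps)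
  ultimately show ?thesis using s t by (intro exI[of _ s] exI[of _ t]) simp
qed

text \<open>If the two values differed, continuity would keep the mixed derivatives apart near
  \<open>x\<close>, each within half the gap of its value there. But one and the same second
  difference, read in both orders, forces a nearby value of one to equal a nearby value of the
  other.\<close>

lemma dir_deriv_commute_real:
  fixes f :: "'a::real_normed_vector \<Rightarrow> real"
  assumes "open S" "Ck_on (Suc (Suc 0)) S f" "x \<in> S"
  shows "dir_deriv a (dir_deriv b f) x = dir_deriv b (dir_deriv a f) x"
proof (rule ccontr)
  define P where "P = dir_deriv a (dir_deriv b f)"
  define Q where "Q = dir_deriv b (dir_deriv a f)"
  assume "dir_deriv a (dir_deriv b f) x \<noteq> dir_deriv b (dir_deriv a f) x"
  then have e: "\<bar>P x - Q x\<bar> / 2 > 0" by (simp add: P_def Q_def)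
  have "isCont P x" "isCont Q x"
    using assms by (auto simp: P_def Q_def continuous_on_eq_continuous_at)
  then obtain d1 d2 where d: "d1 > 0" "\<And>y. dist y x < d1 \<Longrightarrow> dist (P y) (P x) < \<bar>P x - Q x\<bar> / 2"
     "d2 > 0" "\<And>y. dist y x < d2 \<Longrightarrow> dist (Q y) (Q x) < \<bar>P x - Q x\<bar> / 2"
    unfolding continuous_at_eps_delta using e by metis
  obtain d3 where d3: "d3 > 0" "\<And>y. dist y x < d3 \<Longrightarrow> y \<in> S"
    using assms(1,3) open_dist by metis
  define d where "d = min d1 (min d2 d3)"
  \<comment> \<open>At this scale the whole parallelogram lies within \<open>d\<close> of
    \<open>x\<close>; the summand 1 keeps the denominator positive when \<open>a\<close> and
    \<open>b\<close> vanish and makes the bound strict.\<close>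
  define h where "h = d / (norm a + norm b + 1)"
  have "d > 0" using d d3 by (simp add: d_def)
  have n: "norm a + norm b + 1 > 0" by (smt (verit) norm_ge_zero)
  then have "h > 0" using \<open>d > 0\<close> by (simp add: h_def)
  have close: "dist (x + s *\<^sub>R a + t *\<^sub>R b) x < d" if "0 \<le> s" "s \<le> h" "0 \<le> t" "t \<le> h" for s t
  proof -
    have "dist (x + s *\<^sub>R a + t *\<^sub>R b) x \<le> s * norm a + t * norm b"
      using that norm_triangle_ineq[of "s *\<^sub>R a" "t *\<^sub>R b"] by (simp add: dist_norm)
    also have "\<dots> \<le> h * norm a + h * norm b"
      using that by (intro add_mono mult_right_mono) auto
    also have "\<dots> < h * (norm a + norm b + 1)"
      using \<open>h > 0\<close> by (simp add: algebra_simps)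
    also have "\<dots> = d" using n by (simp add: h_def)
    finally show ?thesis .
  qed
  have in_S: "x + s *\<^sub>R a + t *\<^sub>R b \<in> S" "x + s *\<^sub>R b + t *\<^sub>R a \<in> S"
    if "0 \<le> s" "s \<le> h" "0 \<le> t" "t \<le> h" for s t
    using that close[of s t] close[of t s] d3 by (simp_all add: d_def ac_simps)
  obtain s t where st: "0 < s" "s < h" "0 < t" "t < h"
    "f (x + h *\<^sub>R a + h *\<^sub>R b) - f (x + h *\<^sub>R a) - f (x + h *\<^sub>R b) + f x
      = h * (h * Q (x + s *\<^sub>R a + t *\<^sub>R b))"
    using second_difference_mvt[OF assms(2) \<open>h > 0\<close> in_S(1)] unfolding Q_def by blast
  obtain s' t' where st': "0 < s'" "s' < h" "0 < t'" "t' < h"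
    "f (x + h *\<^sub>R b + h *\<^sub>R a) - f (x + h *\<^sub>R b) - f (x + h *\<^sub>R a) + f x
      = h * (h * P (x + s' *\<^sub>R b + t' *\<^sub>R a))"
    using second_difference_mvt[OF assms(2) \<open>h > 0\<close> in_S(2)] unfolding P_def by blast
  have swap: "x + s' *\<^sub>R b + t' *\<^sub>R a = x + t' *\<^sub>R a + s' *\<^sub>R b" "x + h *\<^sub>R b + h *\<^sub>R a = x + h *\<^sub>R a + h *\<^sub>R b"
    by simp_all
  have "h * (h * Q (x + s *\<^sub>R a + t *\<^sub>R b)) = h * (h * P (x + t' *\<^sub>R a + s' *\<^sub>R b))"
    using st(5) st'(5) unfolding swap by linarith
  then have "Q (x + s *\<^sub>R a + t *\<^sub>R b) = P (x + t' *\<^sub>R a + s' *\<^sub>R b)"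
    using \<open>h > 0\<close> by simp
  moreover have "dist (Q (x + s *\<^sub>R a + t *\<^sub>R b)) (Q x) < \<bar>P x - Q x\<bar> / 2"
    using close[of s t] st d(4) by (simp add: d_def)
  moreover have "dist (P (x + t' *\<^sub>R a + s' *\<^sub>R b)) (P x) < \<bar>P x - Q x\<bar> / 2"
    using close[of t' s'] st' d(2) by (simp add: d_def)
  ultimately show False unfolding dist_real_def by (smt (verit) field_sum_of_halves)
qed

lemma dir_deriv_inner:
  assumes "f differentiable at x"
  shows "dir_deriv v (\<lambda>x. f x \<bullet> c) x = dir_deriv v f x \<bullet> c"
  using dir_deriv_eq[OF bounded_linear.has_derivative[OF bounded_linear_inner_left
        assms[unfolded frechet_derivative_works]]]
  by simp

text \<open>The mean value argument is for real values, so the claim is tested on components.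
  Passing to a component must commute with the inner derivative on all of \<open>S\<close>, not only
  at \<open>x\<close>, before the outer derivative is taken.\<close>

lemma smooth_on_dir_deriv_commute:
  fixes f :: "'a::real_normed_vector \<Rightarrow> 'b::euclidean_space"
  assumes "open S" "smooth_on S f" "x \<in> S"
  shows "dir_deriv a (dir_deriv b f) x = dir_deriv b (dir_deriv a f) x"
proof (rule euclidean_eqI)
  fix c :: 'b
  have "dir_deriv u (dir_deriv v f) x \<bullet> c = dir_deriv u (dir_deriv v (\<lambda>x. f x \<bullet> c)) x" for u v
  proof -
    have "dir_deriv u (dir_deriv v (\<lambda>x. f x \<bullet> c)) x = dir_deriv u (\<lambda>x. dir_deriv v f x \<bullet> c) x"
      by (rule fun_cong[OF dir_deriv_cong[OF assms(1,3)]])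
        (simp add: dir_deriv_inner smooth_on_differentiable[OF assms(2)])
    then show ?thesis
      using assms by (simp add: dir_deriv_inner smooth_on_differentiable[OF smooth_on_dir_deriv])
  qed
  moreover have "smooth_on S (\<lambda>x. f x \<bullet> c)"
    using smooth_on_bounded_linear_compose[OF assms(1) bounded_linear_inner_left assms(2)] .
  ultimately show "dir_deriv a (dir_deriv b f) x \<bullet> c = dir_deriv b (dir_deriv a f) x \<bullet> c"
    using dir_deriv_commute_real[OF assms(1) _ assms(3), of "\<lambda>x. f x \<bullet> c"]
    by (metis smooth_on_def)
qed

section \<open>Derivatives in directions that vary with the point\<close>

lemma smooth_on_deriv_apply:
  fixes \<sigma> :: "'a::real_normed_vector \<Rightarrow> 'b::euclidean_space" and f :: "'b \<Rightarrow> 'c::real_normed_vector"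
  assumes "open S" "smooth_on T f" "smooth_on S \<sigma>" "smooth_on S y" "\<sigma> ` S \<subseteq> T"
  shows "smooth_on S (\<lambda>x. frechet_derivative f (at (\<sigma> x)) (y x))"
proof -
  have "smooth_on S (\<lambda>x. \<Sum>b\<in>Basis. (y x \<bullet> b) *\<^sub>R dir_deriv b f (\<sigma> x))"
    by (rule smooth_on_sum[OF assms(1) smooth_on_scaleR[OF assms(1)
            smooth_on_bounded_linear_compose[OF assms(1) bounded_linear_inner_left assms(4)]
            smooth_on_compose[OF assms(1) smooth_on_dir_deriv[OF assms(2)] assms(3,5)]]])
  moreover have "(\<Sum>b\<in>Basis. (y x \<bullet> b) *\<^sub>R dir_deriv b f (\<sigma> x)) = frechet_derivative f (at (\<sigma> x)) (y x)"
    if "x \<in> S" for x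
    using linear_basis_expansion[OF smooth_on_linear[OF assms(2)], of "\<sigma> x" "y x"] that assms(5) by auto
  ultimately show ?thesis by (rule smooth_on_cong[OF assms(1), rotated])
qed

lemma has_derivative_deriv_apply:
  fixes f :: "'a::euclidean_space \<Rightarrow> 'b::euclidean_space"
  assumes "open S" "smooth_on S f" "smooth_on S y" "x \<in> S"
  shows "((\<lambda>x. frechet_derivative f (at x) (y x)) has_derivative
    (\<lambda>v. dir_deriv v (dir_deriv (y x) f) x + frechet_derivative f (at x) (dir_deriv v y x))) (at x)"
proof -
  have "((\<lambda>x. \<Sum>b\<in>Basis. (y x \<bullet> b) *\<^sub>R dir_deriv b f x) has_derivative
    (\<lambda>v. \<Sum>b\<in>Basis. (y x \<bullet> b) *\<^sub>R dir_deriv v (dir_deriv b f) x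
      + (dir_deriv v y x \<bullet> b) *\<^sub>R dir_deriv b f x)) (at x)"
    by (intro has_derivative_sum has_derivative_scaleR
        bounded_linear.has_derivative[OF bounded_linear_inner_left]
        smooth_on_has_derivative[OF assms(3,4)]
        smooth_on_has_derivative[OF smooth_on_dir_deriv[OF assms(2)] assms(4)])
  moreover have "(\<Sum>b\<in>Basis. (y x \<bullet> b) *\<^sub>R dir_deriv v (dir_deriv b f) x
      + (dir_deriv v y x \<bullet> b) *\<^sub>R dir_deriv b f x)
    = dir_deriv v (dir_deriv (y x) f) x + frechet_derivative f (at x) (dir_deriv v y x)" for v
    using linear_basis_expansion[OF smooth_on_linear[OF assms(2,4)], of "dir_deriv v y x"]
      linear_basis_expansion[OF smooth_on_linear[OF smooth_on_dir_deriv[OF assms(2)] assms(4)], of v "y x"]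
      smooth_on_dir_deriv_commute[OF assms(1,2,4)]
    by (simp add: sum.distrib)
  ultimately have "((\<lambda>x. \<Sum>b\<in>Basis. (y x \<bullet> b) *\<^sub>R dir_deriv b f x) has_derivative
    (\<lambda>v. dir_deriv v (dir_deriv (y x) f) x + frechet_derivative f (at x) (dir_deriv v y x))) (at x)"
    by simp
  then show ?thesis
    by (rule has_derivative_transform_within_open[OF _ assms(1,4)])
      (rule linear_basis_expansion[OF smooth_on_linear[OF assms(2)], symmetric])
qed

text \<open>After commuting, \<open>v\<close> is the outer direction, where linearity is that of a
  Frechet derivative.\<close>

lemma linear_dir_deriv2:
  fixes f :: "'a::real_normed_vector \<Rightarrow> 'b::euclidean_space"
  assumes "open S" "smooth_on S f" "x \<in> S"
  shows "linear (\<lambda>v. dir_deriv u (dir_deriv v f) x)"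
proof -
  have "(\<lambda>v. dir_deriv u (dir_deriv v f) x) = frechet_derivative (dir_deriv u f) (at x)"
    by (rule ext) (rule smooth_on_dir_deriv_commute[OF assms])
  then show ?thesis
    using smooth_on_linear[OF smooth_on_dir_deriv[OF assms(2)] assms(3), of u] by simp
qed

text \<open>The two inner derivatives are commuted on all of \<open>S\<close>, so that the outer one
  respects the exchange; this reduces the claim to two derivatives of
  \<open>dir_deriv u f\<close>.\<close>

lemma linear_dir_deriv3:
  fixes f :: "'a::real_normed_vector \<Rightarrow> 'b::euclidean_space"
  assumes "open S" "smooth_on S f" "x \<in> S"
  shows "linear (\<lambda>v. dir_deriv w (dir_deriv u (dir_deriv v f)) x)"
proof -
  have "dir_deriv w (dir_deriv u (dir_deriv v f)) x = dir_deriv w (dir_deriv v (dir_deriv u f)) x" for v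
    by (rule fun_cong[OF dir_deriv_cong[OF assms(1,3)]]) (rule smooth_on_dir_deriv_commute[OF assms(1,2)])
  then show ?thesis
    using linear_dir_deriv2[OF assms(1) smooth_on_dir_deriv[OF assms(2), of u] assms(3), of w] by simp
qed

text \<open>Only the inner direction is expanded; for each fixed basis vector the outer one is
  covered by \<open>smooth_on_deriv_apply\<close>. With \<sigma> the section given by
  \<open>V\<close> and vertical directions, this is the smoothness of \<open>g_field\<close>; the
  version with three derivatives serves \<open>C_field\<close>.\<close>

lemma smooth_on_dir_deriv2_apply:
  fixes \<sigma> :: "'a::real_normed_vector \<Rightarrow> 'b::euclidean_space" and f :: "'b \<Rightarrow> 'c::euclidean_space"
  assumes "open S" "open T" "smooth_on T f" "smooth_on S \<sigma>" "\<sigma> ` S \<subseteq> T"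
    "smooth_on S u" "smooth_on S v"
  shows "smooth_on S (\<lambda>x. dir_deriv (u x) (dir_deriv (v x) f) (\<sigma> x))"
proof -
  have "smooth_on S (\<lambda>x. \<Sum>b\<in>Basis. (v x \<bullet> b) *\<^sub>R dir_deriv (u x) (dir_deriv b f) (\<sigma> x))"
    by (rule smooth_on_sum[OF assms(1) smooth_on_scaleR[OF assms(1)
            smooth_on_bounded_linear_compose[OF assms(1) bounded_linear_inner_left assms(7)]
            smooth_on_deriv_apply[OF assms(1) smooth_on_dir_deriv[OF assms(3)] assms(4,6,5)]]])
  moreover have "(\<Sum>b\<in>Basis. (v x \<bullet> b) *\<^sub>R dir_deriv (u x) (dir_deriv b f) (\<sigma> x))
      = dir_deriv (u x) (dir_deriv (v x) f) (\<sigma> x)" if "x \<in> S" for x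
    by (rule linear_basis_expansion[symmetric, OF linear_dir_deriv2[OF assms(2,3)]])
      (use that assms(5) in auto)
  ultimately show ?thesis by (rule smooth_on_cong[OF assms(1), rotated])
qed

lemma smooth_on_dir_deriv3_apply:
  fixes \<sigma> :: "'a::real_normed_vector \<Rightarrow> 'b::euclidean_space" and f :: "'b \<Rightarrow> 'c::euclidean_space"
  assumes "open S" "open T" "smooth_on T f" "smooth_on S \<sigma>" "\<sigma> ` S \<subseteq> T"
    "smooth_on S u" "smooth_on S v" "smooth_on S w"
  shows "smooth_on S (\<lambda>x. dir_deriv (u x) (dir_deriv (v x) (dir_deriv (w x) f)) (\<sigma> x))"
proof -
  have "smooth_on S (\<lambda>x. \<Sum>b\<in>Basis. (w x \<bullet> b) *\<^sub>R dir_deriv (u x) (dir_deriv (v x) (dir_deriv b f)) (\<sigma> x))"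
    by (rule smooth_on_sum[OF assms(1) smooth_on_scaleR[OF assms(1)
            smooth_on_bounded_linear_compose[OF assms(1) bounded_linear_inner_left assms(8)]
            smooth_on_dir_deriv2_apply[OF assms(1,2) smooth_on_dir_deriv[OF assms(3)] assms(4,5,6,7)]]])
  moreover have "(\<Sum>b\<in>Basis. (w x \<bullet> b) *\<^sub>R dir_deriv (u x) (dir_deriv (v x) (dir_deriv b f)) (\<sigma> x))
      = dir_deriv (u x) (dir_deriv (v x) (dir_deriv (w x) f)) (\<sigma> x)" if "x \<in> S" for x
    by (rule linear_basis_expansion[symmetric, OF linear_dir_deriv3[OF assms(2,3)]])
      (use that assms(5) in auto)
  ultimately show ?thesis by (rule smooth_on_cong[OF assms(1), rotated])
qed

section \<open>Iterated derivatives along lines\<close>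

lemma deriv_line:
  fixes f :: "'a::real_normed_vector \<Rightarrow> real"
  assumes "f differentiable at x"
  shows "deriv (\<lambda>t. f (x + t *\<^sub>R v)) 0 = dir_deriv v f x"
proof -
  have d: "(f has_derivative frechet_derivative f (at x)) (at (x + 0 *\<^sub>R v))"
    using assms by (simp add: frechet_derivative_works[symmetric])
  have "((\<lambda>t. x + t *\<^sub>R v) has_derivative (\<lambda>r. r *\<^sub>R v)) (at (0::real))"
    by (auto intro!: derivative_eq_intros)
  from has_derivative_compose[OF this d]
  have "((\<lambda>t. f (x + t *\<^sub>R v)) has_derivative (\<lambda>r. frechet_derivative f (at x) (r *\<^sub>R v))) (at 0)" .
  moreover have "(\<lambda>r. frechet_derivative f (at x) (r *\<^sub>R v)) = (*) (dir_deriv v f x)"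
    using linear_scale[OF frechet_derivative_linear[OF assms]] by auto
  ultimately show ?thesis
    by (intro DERIV_imp_deriv) (simp add: has_field_derivative_def)
qed

text \<open>Nothing is known about \<open>f\<close> outside \<open>S\<close>, but
  \<open>deriv\<close> at 0 sees only small parameters, for which the line stays in
  \<open>S\<close>.\<close>

lemma eventually_line_in_open:
  fixes x v :: "'a::real_normed_vector"
  assumes "open S" "x \<in> S"
  shows "eventually (\<lambda>t. x + t *\<^sub>R v \<in> S) (nhds (0::real))"
proof -
  have "open ((\<lambda>t. x + t *\<^sub>R v) -` S)"
    by (intro open_vimage assms(1) continuous_intros)
  then show ?thesis
    using assms(2) unfolding eventually_nhds by (intro exI[of _ "(\<lambda>t. x + t *\<^sub>R v) -` S"]) auto
qed

lemma deriv_line2: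
  fixes f :: "'a::real_normed_vector \<Rightarrow> real"
  assumes "open S" "smooth_on S f" "x \<in> S"
  shows "deriv (\<lambda>t. deriv (\<lambda>s. f (x + t *\<^sub>R u + s *\<^sub>R v)) 0) 0 = dir_deriv u (dir_deriv v f) x"
proof -
  have "eventually (\<lambda>t. deriv (\<lambda>s. f (x + t *\<^sub>R u + s *\<^sub>R v)) 0 = dir_deriv v f (x + t *\<^sub>R u)) (nhds 0)"
    using eventually_line_in_open[OF assms(1,3)]
    by eventually_elim (rule deriv_line[OF smooth_on_differentiable[OF assms(2)]])
  then have "deriv (\<lambda>t. deriv (\<lambda>s. f (x + t *\<^sub>R u + s *\<^sub>R v)) 0) 0
      = deriv (\<lambda>t. dir_deriv v f (x + t *\<^sub>R u)) 0"
    by (rule deriv_cong_ev) simp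
  also have "\<dots> = dir_deriv u (dir_deriv v f) x"
    by (rule deriv_line[OF smooth_on_differentiable[OF smooth_on_dir_deriv[OF assms(2)] assms(3)]])
  finally show ?thesis .
qed

lemma deriv_line3:
  fixes f :: "'a::real_normed_vector \<Rightarrow> real"
  assumes "open S" "smooth_on S f" "x \<in> S"
  shows "deriv (\<lambda>r. deriv (\<lambda>t. deriv (\<lambda>s. f (x + s *\<^sub>R w + t *\<^sub>R v + r *\<^sub>R u)) 0) 0) 0
    = dir_deriv u (dir_deriv v (dir_deriv w f)) x"
proof -
  \<comment> \<open>The increment of the outermost parameter is moved next to \<open>x\<close>, so
    that \<open>deriv_line2\<close> applies at the shifted base point; the last line of the proof
    restores the order of the summands.\<close>
  have "eventually (\<lambda>r. deriv (\<lambda>t. deriv (\<lambda>s. f ((x + r *\<^sub>R u) + t *\<^sub>R v + s *\<^sub>R w)) 0) 0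
      = dir_deriv v (dir_deriv w f) (x + r *\<^sub>R u)) (nhds 0)"
    using eventually_line_in_open[OF assms(1,3)]
    by eventually_elim (rule deriv_line2[OF assms(1,2)])
  then have "deriv (\<lambda>r. deriv (\<lambda>t. deriv (\<lambda>s. f ((x + r *\<^sub>R u) + t *\<^sub>R v + s *\<^sub>R w)) 0) 0) 0
      = deriv (\<lambda>r. dir_deriv v (dir_deriv w f) (x + r *\<^sub>R u)) 0"
    by (rule deriv_cong_ev) simp
  also have "\<dots> = dir_deriv u (dir_deriv v (dir_deriv w f)) x"
    by (rule deriv_line[OF smooth_on_differentiable[OF smooth_on_dir_deriv[OF smooth_on_dir_deriv[OF assms(2)]] assms(3)]])
  finally show ?thesis by (simp add: ac_simps)
qed

text \<open>Differentiating a bracket yields second derivatives and compositions of first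
  derivatives. In the cyclic sum the compositions cancel formally and the second derivatives cancel
  in pairs by symmetry.\<close>

lemma jacobi_identity_coordinates:
  fixes X Y Z :: "'a::euclidean_space \<Rightarrow> 'a"
  defines "br \<equiv> \<lambda>f g x. frechet_derivative g (at x) (f x) - frechet_derivative f (at x) (g x)"
  assumes "open S" "smooth_on S X" "smooth_on S Y" "smooth_on S Z" "x \<in> S"
  shows "br X (br Y Z) x + br Y (br Z X) x + br Z (br X Y) x = 0"
proof -
  have D: "frechet_derivative (br f g) (at x) v
    = (dir_deriv v (dir_deriv (f x) g) x + frechet_derivative g (at x) (dir_deriv v f x))
      - (dir_deriv v (dir_deriv (g x) f) x + frechet_derivative f (at x) (dir_deriv v g x))"
    if "smooth_on S f" "smooth_on S g" for f g v
    using dir_deriv_eq[OF has_derivative_diff[OF has_derivative_deriv_apply[OF assms(2) that(2,1) assms(6)]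
        has_derivative_deriv_apply[OF assms(2) that assms(6)]]]
    by (simp add: br_def)
  have lin: "frechet_derivative f (at x) (br g h x) =
     frechet_derivative f (at x) (frechet_derivative h (at x) (g x))
     - frechet_derivative f (at x) (frechet_derivative g (at x) (h x))"
    if "smooth_on S f" for f g h
    using linear_diff[OF smooth_on_linear[OF that assms(6)]] by (simp add: br_def)
  have br: "br f h x = frechet_derivative h (at x) (f x) - frechet_derivative f (at x) (h x)" for f h
    by (simp add: br_def)
  note c = smooth_on_dir_deriv_commute[OF assms(2) _ assms(6)]
  show ?thesis
    unfolding br[of _ "br _ _"] D[OF assms(3,4)] D[OF assms(4,5)] D[OF assms(5,3)]
      lin[OF assms(3)] lin[OF assms(4)] lin[OF assms(5)]
    using c[OF assms(3), of "Y x" "Z x"] c[OF assms(4), of "X x" "Z x"] c[OF assms(5), of "X x" "Y x"]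
    by (simp add: algebra_simps)
qed

section \<open>Vector fields on a manifold\<close>

definition coord :: "('m, 'a) chart \<Rightarrow> ('m, 'a) vfield \<Rightarrow> 'a \<Rightarrow> 'a" where
  "coord c X = (\<lambda>x. X (inv_chart c x) c)"

lemma coord_add: "coord c (X + Y) = (\<lambda>x. coord c X x + coord c Y x)"
  by (simp add: coord_def plus_fun_def)

lemma coord_uminus: "coord c (- X) = (\<lambda>x. - coord c X x)"
  by (simp add: coord_def fun_Compl_def)

locale smooth_manifold =
  fixes atl :: "('m::{t2_space,second_countable_topology}, 'a::euclidean_space) chart set"
  assumes atlas: "smooth_atlas atl"
begin

section \<open>Charts and tangent spaces\<close>

lemma ex_chart: "\<exists>c. c \<in> atl \<and> p \<in> fst c"
  using atlas unfolding smooth_atlas_def by blast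

lemma chart_homeomorphism:
  "c \<in> atl \<Longrightarrow> homeomorphism (fst c) (snd c ` fst c) (snd c) (inv_chart c)"
  using atlas unfolding smooth_atlas_def by blast

lemma open_chart: "c \<in> atl \<Longrightarrow> open (fst c)" "c \<in> atl \<Longrightarrow> open (snd c ` fst c)"
  using atlas unfolding smooth_atlas_def by blast+

lemma inv_chart_chart: "c \<in> atl \<Longrightarrow> p \<in> fst c \<Longrightarrow> inv_chart c (snd c p) = p"
  using homeomorphism_apply1[OF chart_homeomorphism] .

lemma open_chart_image:
  assumes "c \<in> atl" "open \<Omega>"
  shows "open (snd c ` (fst c \<inter> \<Omega>))"
  using homeomorphism_imp_open_map[OF chart_homeomorphism[OF assms(1)], of "fst c \<inter> \<Omega>"]
    open_chart[OF assms(1)] assms(2) by (simp add: openin_open_eq open_Int)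

lemma transition_smooth:
  "c \<in> atl \<Longrightarrow> d \<in> atl \<Longrightarrow> smooth_on (snd c ` (fst c \<inter> fst d)) (snd d \<circ> inv_chart c)"
  using atlas unfolding smooth_atlas_def by blast

lemma transition_has_derivative:
  assumes "c \<in> atl" "d \<in> atl" "p \<in> fst c" "p \<in> fst d"
  shows "((snd d \<circ> inv_chart c) has_derivative frechet_derivative (snd d \<circ> inv_chart c) (at (snd c p))) (at (snd c p))"
  using smooth_on_has_derivative[OF transition_smooth[OF assms(1,2)]] assms(3,4) by blast

lemma transition_linear:
  assumes "c \<in> atl" "d \<in> atl" "p \<in> fst c" "p \<in> fst d"
  shows "linear (frechet_derivative (snd d \<circ> inv_chart c) (at (snd c p)))"
  using has_derivative_linear[OF transition_has_derivative[OF assms]] .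

lemma tangent_space_transition:
  assumes "u \<in> tangent_space atl p" "c \<in> atl" "d \<in> atl" "p \<in> fst c" "p \<in> fst d"
  shows "u d = frechet_derivative (snd d \<circ> inv_chart c) (at (snd c p)) (u c)"
  using assms unfolding tangent_space_def by blast

lemma tangent_space_outside:
  assumes "u \<in> tangent_space atl p" "\<not> (c \<in> atl \<and> p \<in> fst c)"
  shows "u c = 0"
  using assms unfolding tangent_space_def by blast

lemma tangent_spaceI:
  assumes "\<And>c. \<not> (c \<in> atl \<and> p \<in> fst c) \<Longrightarrow> u c = 0"
    and "\<And>c d. c \<in> atl \<Longrightarrow> d \<in> atl \<Longrightarrow> p \<in> fst c \<Longrightarrow> p \<in> fst d \<Longrightarrow>
      u d = frechet_derivative (snd d \<circ> inv_chart c) (at (snd c p)) (u c)"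
  shows "u \<in> tangent_space atl p"
  using assms unfolding tangent_space_def by blast

lemma tangent_space_add:
  assumes "u \<in> tangent_space atl p" "v \<in> tangent_space atl p"
  shows "u + v \<in> tangent_space atl p"
proof (rule tangent_spaceI)
  fix c d assume cd: "c \<in> atl" "d \<in> atl" "p \<in> fst c" "p \<in> fst d"
  show "(u + v) d = frechet_derivative (snd d \<circ> inv_chart c) (at (snd c p)) ((u + v) c)"
    using assms[THEN tangent_space_transition, OF cd] linear_add[OF transition_linear[OF cd]] by simp
qed (use assms[THEN tangent_space_outside] in simp)

lemma tangent_space_scale:
  assumes "u \<in> tangent_space atl p"
  shows "r *\<^sub>T u \<in> tangent_space atl p"
proof (rule tangent_spaceI)
  fix c d assume cd: "c \<in> atl" "d \<in> atl" "p \<in> fst c" "p \<in> fst d"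
  show "(r *\<^sub>T u) d = frechet_derivative (snd d \<circ> inv_chart c) (at (snd c p)) ((r *\<^sub>T u) c)"
    using assms[THEN tangent_space_transition, OF cd] linear_scale[OF transition_linear[OF cd]]
    by (simp add: tscale_def)
qed (use assms[THEN tangent_space_outside] in \<open>simp add: tscale_def\<close>)

lemma tangent_space_zero: "0 \<in> tangent_space atl p"
  by (rule tangent_spaceI) (simp_all add: linear_0[OF transition_linear])

lemma tangent_space_uminus:
  assumes "u \<in> tangent_space atl p"
  shows "- u \<in> tangent_space atl p"
proof -
  have "- u = (- 1) *\<^sub>T u" by (simp add: tscale_def fun_Compl_def)
  then show ?thesis using tangent_space_scale[OF assms] by metis
qed

text \<open>One component determines the whole family: the transformation law gives the entries in
  charts around \<open>p\<close>, and the zero convention gives the others. Hence \<open>L\<close>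
  at \<open>(p, u)\<close> can be computed in coordinates.\<close>

lemma inv_bundle_chart_chart:
  assumes "u \<in> tangent_space atl p" "c \<in> atl" "p \<in> fst c"
  shows "inv_bundle_chart atl c (snd c p, u c) = (p, u)"
proof -
  have "(if d \<in> atl \<and> p \<in> fst d then frechet_derivative (snd d \<circ> inv_chart c) (at (snd c p)) (u c) else 0) = u d"
    for d
  proof (cases "d \<in> atl \<and> p \<in> fst d")
    case True
    then show ?thesis using tangent_space_transition[OF assms(1,2) _ assms(3), of d] by simp
  next
    case False
    then show ?thesis using tangent_space_outside[OF assms(1) False] by auto
  qed
  then show ?thesis
    using assms(2,3) by (simp add: inv_bundle_chart_def inv_chart_chart)
qed

end

locale open_submanifold = smooth_manifold atl
  for atl :: "('m::{t2_space,second_countable_topology}, 'a::euclidean_space) chart set" +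
  fixes \<Omega> :: "'m set"
  assumes open_\<Omega>: "open \<Omega>"
begin

abbreviation dom :: "('m, 'a) chart \<Rightarrow> 'a set" where
  "dom c \<equiv> snd c ` (fst c \<inter> \<Omega>)"

abbreviation VF :: "('m, 'a) vfield set" where
  "VF \<equiv> vector_fields atl \<Omega>"

lemma open_dom: "c \<in> atl \<Longrightarrow> open (dom c)"
  using open_chart_image[OF _ open_\<Omega>] .

lemma VF_tangent: "X \<in> VF \<Longrightarrow> p \<in> \<Omega> \<Longrightarrow> X p \<in> tangent_space atl p"
  unfolding vector_fields_def by blast

lemma VF_outside: "X \<in> VF \<Longrightarrow> p \<notin> \<Omega> \<Longrightarrow> X p = 0"
  unfolding vector_fields_def by blast

lemma VF_smooth: "X \<in> VF \<Longrightarrow> c \<in> atl \<Longrightarrow> smooth_on (dom c) (coord c X)"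
  unfolding vector_fields_def coord_def by blast

lemma coord_chart: "c \<in> atl \<Longrightarrow> p \<in> fst c \<Longrightarrow> coord c X (snd c p) = X p c"
  by (simp add: coord_def inv_chart_chart)

lemma VF_intro:
  assumes "\<And>p. p \<in> \<Omega> \<Longrightarrow> X p \<in> tangent_space atl p" "\<And>p. p \<notin> \<Omega> \<Longrightarrow> X p = 0"
    "\<And>c. c \<in> atl \<Longrightarrow> smooth_on (dom c) (coord c X)"
  shows "X \<in> VF"
  using assms unfolding vector_fields_def coord_def by blast

lemma VF_add: "X \<in> VF \<Longrightarrow> Y \<in> VF \<Longrightarrow> X + Y \<in> VF"
  by (rule VF_intro)
    (simp_all add: coord_add smooth_on_add open_dom VF_smooth VF_tangent tangent_space_add,
      simp add: VF_outside fun_eq_iff)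

lemma VF_uminus: "X \<in> VF \<Longrightarrow> - X \<in> VF"
  by (rule VF_intro)
    (simp_all add: coord_uminus smooth_on_minus open_dom VF_smooth VF_tangent tangent_space_uminus,
      simp add: VF_outside fun_eq_iff)

lemma VF_diff: "X \<in> VF \<Longrightarrow> Y \<in> VF \<Longrightarrow> X - Y \<in> VF"
  using VF_add[OF _ VF_uminus] by fastforce

lemma VF_zero: "0 \<in> VF"
  by (rule VF_intro) (simp_all add: tangent_space_zero coord_def smooth_on_const)

section \<open>The Lie bracket of vector fields\<close>

lemma lie_bracket_outside:
  "\<not> (p \<in> \<Omega> \<and> c \<in> atl \<and> p \<in> fst c) \<Longrightarrow> lie_bracket atl \<Omega> X Y p c = 0"
  by (auto simp: lie_bracket_def)

lemma coord_lie_bracket: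
  assumes "c \<in> atl" "x \<in> dom c"
  shows "coord c (lie_bracket atl \<Omega> X Y) x =
    frechet_derivative (coord c Y) (at x) (coord c X x) - frechet_derivative (coord c X) (at x) (coord c Y x)"
  using assms by (auto simp: coord_chart) (simp add: lie_bracket_def coord_def)

lemma lie_bracket_eq:
  assumes "p \<in> \<Omega>" "c \<in> atl" "p \<in> fst c"
  shows "lie_bracket atl \<Omega> X Y p c =
    dir_deriv (X p c) (coord c Y) (snd c p) - dir_deriv (Y p c) (coord c X) (snd c p)"
  using assms by (simp add: lie_bracket_def coord_def)

lemma lie_bracket_antisym: "lie_bracket atl \<Omega> Y X = - lie_bracket atl \<Omega> X Y"
  by (auto simp: lie_bracket_def fun_eq_iff)

lemma jacobi_identity:
  assumes "X \<in> VF" "Y \<in> VF" "Z \<in> VF"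
  shows "lie_bracket atl \<Omega> X (lie_bracket atl \<Omega> Y Z) + lie_bracket atl \<Omega> Y (lie_bracket atl \<Omega> Z X)
    + lie_bracket atl \<Omega> Z (lie_bracket atl \<Omega> X Y) = 0"
proof (rule ext, rule ext)
  fix p c
  show "(lie_bracket atl \<Omega> X (lie_bracket atl \<Omega> Y Z) + lie_bracket atl \<Omega> Y (lie_bracket atl \<Omega> Z X)
    + lie_bracket atl \<Omega> Z (lie_bracket atl \<Omega> X Y)) p c = 0 p c"
  proof (cases "p \<in> \<Omega> \<and> c \<in> atl \<and> p \<in> fst c")
    case True
    then have c: "c \<in> atl" "snd c p \<in> dom c" by auto
    define br where
      "br = (\<lambda>f g x. frechet_derivative g (at x) (f x) - frechet_derivative f (at x) (g x :: 'a) :: 'a)"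
    \<comment> \<open>The outer bracket differentiates the inner one, so the coordinate formula for
      the latter is used on the open set \<open>dom c\<close>. The same formula defines the bracket
      in every chart, so no change of charts enters.\<close>
    have inner: "frechet_derivative (coord c (lie_bracket atl \<Omega> A B)) (at (snd c p))
      = frechet_derivative (br (coord c A) (coord c B)) (at (snd c p))" for A B
      by (rule dir_deriv_cong[OF open_dom[OF c(1)] c(2)]) (simp add: coord_lie_bracket[OF c(1)] br_def)
    have "lie_bracket atl \<Omega> A (lie_bracket atl \<Omega> B D) p c
      = br (coord c A) (br (coord c B) (coord c D)) (snd c p)" for A B D
      using coord_lie_bracket[OF c, of A "lie_bracket atl \<Omega> B D"] coord_lie_bracket[OF c, of B D]
        inner[of B D] True by (simp add: coord_chart br_def)
    then show ?thesis
      using jacobi_identity_coordinates[OF open_dom[OF c(1)] VF_smooth[OF assms(1) c(1)]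
          VF_smooth[OF assms(2) c(1)] VF_smooth[OF assms(3) c(1)] c(2)]
      by (simp add: br_def)
  qed (simp add: lie_bracket_outside)
qed

section \<open>Smooth functions and their derivatives along vector fields\<close>

lemma smooth_functionD:
  "smooth_function atl \<Omega> f \<Longrightarrow> c \<in> atl \<Longrightarrow> smooth_on (dom c) (f \<circ> inv_chart c)"
  unfolding smooth_function_def by blast

lemma smooth_function_add:
  assumes "smooth_function atl \<Omega> f" "smooth_function atl \<Omega> h"
  shows "smooth_function atl \<Omega> (\<lambda>p. f p + h p)"
  unfolding smooth_function_def
proof
  fix c assume c: "c \<in> atl"
  show "smooth_on (dom c) ((\<lambda>p. f p + h p) \<circ> inv_chart c)"
    using smooth_on_add[OF open_dom[OF c] assms[THEN smooth_functionD, OF c]] by (simp add: comp_def)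
qed

lemma smooth_function_cmult:
  assumes "smooth_function atl \<Omega> f"
  shows "smooth_function atl \<Omega> (\<lambda>p. r * f p)"
  unfolding smooth_function_def
proof
  fix c assume c: "c \<in> atl"
  show "smooth_on (dom c) ((\<lambda>p. r * f p) \<circ> inv_chart c)"
    using smooth_on_bounded_linear_compose[OF open_dom[OF c] bounded_linear_mult_right assms[THEN smooth_functionD, OF c]]
    by (simp add: comp_def)
qed

text \<open>Near \<open>snd c p\<close> the two coordinate forms of \<open>f\<close> differ by the
  transition map, whose derivative carries \<open>X p c\<close> to \<open>X p d\<close>; the chain
  rule then frees \<open>vderiv\<close> from its chosen chart.\<close>

lemma vderiv_eq:
  assumes "X \<in> VF" "smooth_function atl \<Omega> f" "p \<in> \<Omega>" "c \<in> atl" "p \<in> fst c"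
  shows "vderiv atl X f p = dir_deriv (X p c) (f \<circ> inv_chart c) (snd c p)"
proof -
  define d where "d = (SOME c. c \<in> atl \<and> p \<in> fst c)"
  have d: "d \<in> atl" "p \<in> fst d"
    using someI_ex[OF ex_chart[of p]] by (simp_all add: d_def)
  let ?T = "snd d \<circ> inv_chart c"
  have T: "?T (snd c p) = snd d p"
    using assms by (simp add: inv_chart_chart)
  have "((f \<circ> inv_chart d) has_derivative frechet_derivative (f \<circ> inv_chart d) (at (snd d p))) (at (?T (snd c p)))"
    unfolding T using smooth_on_has_derivative[OF smooth_functionD[OF assms(2) d(1)]] d assms(3) by blast
  from has_derivative_compose[OF transition_has_derivative[OF assms(4) d(1) assms(5) d(2)] this]
  have "((\<lambda>x. (f \<circ> inv_chart d) (?T x)) has_derivative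
    (\<lambda>v. frechet_derivative (f \<circ> inv_chart d) (at (snd d p)) (frechet_derivative ?T (at (snd c p)) v))) (at (snd c p))" .
  then have "((f \<circ> inv_chart c) has_derivative
    (\<lambda>v. frechet_derivative (f \<circ> inv_chart d) (at (snd d p)) (frechet_derivative ?T (at (snd c p)) v))) (at (snd c p))"
    by (rule has_derivative_transform_within_open[OF _ open_chart_image[OF assms(4) open_chart(1)[OF d(1)]]])
      (use assms(4,5) d in \<open>auto simp: inv_chart_chart\<close>)
  then have "frechet_derivative (f \<circ> inv_chart c) (at (snd c p)) (X p c)
    = frechet_derivative (f \<circ> inv_chart d) (at (snd d p)) (X p d)"
    using tangent_space_transition[OF VF_tangent[OF assms(1,3)] assms(4) d(1) assms(5) d(2)]
    by (simp add: dir_deriv_eq)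
  then show ?thesis
    by (simp add: vderiv_def Let_def d_def)
qed

lemma vderiv_coord:
  assumes "X \<in> VF" "smooth_function atl \<Omega> f" "c \<in> atl" "x \<in> dom c"
  shows "(vderiv atl X f \<circ> inv_chart c) x = frechet_derivative (f \<circ> inv_chart c) (at x) (coord c X x)"
  using assms by (auto simp: inv_chart_chart vderiv_eq coord_chart)

lemma smooth_function_vderiv:
  assumes "X \<in> VF" "smooth_function atl \<Omega> f"
  shows "smooth_function atl \<Omega> (vderiv atl X f)"
  unfolding smooth_function_def
proof
  fix c assume c: "c \<in> atl"
  have "smooth_on (dom c) (\<lambda>x. frechet_derivative (f \<circ> inv_chart c) (at x) (coord c X x))"
    by (rule smooth_on_deriv_apply[OF open_dom[OF c] smooth_functionD[OF assms(2) c] smooth_on_ident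
          VF_smooth[OF assms(1) c]]) simp
  then show "smooth_on (dom c) (vderiv atl X f \<circ> inv_chart c)"
    by (rule smooth_on_cong[OF open_dom[OF c], rotated]) (simp only: vderiv_coord[OF assms c])
qed

text \<open>Almost compatibility describes a derivative of \<open>g_field\<close> only on \<Omega>;
  since \<Omega> is open, this is enough to differentiate the resulting expression again.\<close>

lemma vderiv_cong:
  assumes "p \<in> \<Omega>" "\<And>q. q \<in> \<Omega> \<Longrightarrow> f q = h q"
  shows "vderiv atl X f p = vderiv atl X h p"
proof -
  define d where "d = (SOME c. c \<in> atl \<and> p \<in> fst c)"
  have d: "d \<in> atl" "p \<in> fst d"
    using someI_ex[OF ex_chart[of p]] by (simp_all add: d_def)
  have "frechet_derivative (f \<circ> inv_chart d) (at (snd d p)) = frechet_derivative (h \<circ> inv_chart d) (at (snd d p))"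
    by (rule dir_deriv_cong[OF open_dom[OF d(1)]]) (use d assms in \<open>auto simp: inv_chart_chart\<close>)
  then show ?thesis by (simp add: vderiv_def Let_def d_def)
qed

lemma vderiv_add:
  assumes "X \<in> VF" "smooth_function atl \<Omega> f" "smooth_function atl \<Omega> h" "p \<in> \<Omega>"
  shows "vderiv atl X (\<lambda>q. f q + h q) p = vderiv atl X f p + vderiv atl X h p"
proof -
  obtain c where c: "c \<in> atl" "p \<in> fst c" using ex_chart by blast
  then have x: "snd c p \<in> dom c" using assms(4) by blast
  have "dir_deriv v ((\<lambda>q. f q + h q) \<circ> inv_chart c) (snd c p)
    = dir_deriv v (f \<circ> inv_chart c) (snd c p) + dir_deriv v (h \<circ> inv_chart c) (snd c p)" for v
    using dir_deriv_eq[OF has_derivative_add[OF smooth_on_has_derivative[OF smooth_functionD[OF assms(2) c(1)] x]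
        smooth_on_has_derivative[OF smooth_functionD[OF assms(3) c(1)] x]]]
    by (simp add: comp_def)
  then show ?thesis
    using vderiv_eq[OF assms(1) smooth_function_add[OF assms(2,3)] assms(4) c]
      vderiv_eq[OF assms(1,2,4) c] vderiv_eq[OF assms(1,3,4) c] by simp
qed

lemma vderiv_cmult:
  assumes "X \<in> VF" "smooth_function atl \<Omega> f" "p \<in> \<Omega>"
  shows "vderiv atl X (\<lambda>q. r * f q) p = r * vderiv atl X f p"
proof -
  obtain c where c: "c \<in> atl" "p \<in> fst c" using ex_chart by blast
  then have x: "snd c p \<in> dom c" using assms(3) by blast
  have "dir_deriv v ((\<lambda>q. r * f q) \<circ> inv_chart c) (snd c p) = r * dir_deriv v (f \<circ> inv_chart c) (snd c p)" for v
    using dir_deriv_eq[OF has_derivative_mult_right[OF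
          smooth_on_has_derivative[OF smooth_functionD[OF assms(2) c(1)] x]]]
    by (simp add: comp_def)
  then show ?thesis
    using vderiv_eq[OF assms(1) smooth_function_cmult[OF assms(2)] assms(3) c]
      vderiv_eq[OF assms c] by simp
qed

text \<open>In a chart, \<open>X (Y f)\<close> is a second derivative of \<open>f\<close> plus the
  derivative of \<open>f\<close> along \<open>DY(X)\<close>. Antisymmetrizing removes the former by
  symmetry and leaves the coordinate formula of the bracket. That the bracket is a vector field is
  assumed here and later supplied by torsion-freeness.\<close>

lemma vderiv_lie_bracket:
  assumes "X \<in> VF" "Y \<in> VF" "lie_bracket atl \<Omega> X Y \<in> VF" "smooth_function atl \<Omega> f" "p \<in> \<Omega>"
  shows "vderiv atl (lie_bracket atl \<Omega> X Y) f p
    = vderiv atl X (vderiv atl Y f) p - vderiv atl Y (vderiv atl X f) p"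
proof -
  obtain c where c: "c \<in> atl" "p \<in> fst c" using ex_chart by blast
  then have x: "snd c p \<in> dom c" using assms(5) by blast
  let ?F = "f \<circ> inv_chart c"
  have F: "smooth_on (dom c) ?F" by (rule smooth_functionD[OF assms(4) c(1)])
  have *: "vderiv atl A (vderiv atl B f) p = dir_deriv (A p c) (dir_deriv (B p c) ?F) (snd c p)
      + dir_deriv (dir_deriv (A p c) (coord c B) (snd c p)) ?F (snd c p)"
    if "A \<in> VF" "B \<in> VF" for A B
  proof -
    have "vderiv atl A (vderiv atl B f) p = dir_deriv (A p c) (vderiv atl B f \<circ> inv_chart c) (snd c p)"
      by (rule vderiv_eq[OF that(1) smooth_function_vderiv[OF that(2) assms(4)] assms(5) c])
    also have "\<dots> = dir_deriv (A p c) (\<lambda>x. frechet_derivative ?F (at x) (coord c B x)) (snd c p)"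
      by (rule fun_cong[OF dir_deriv_cong[OF open_dom[OF c(1)] x]])
        (simp only: vderiv_coord[OF that(2) assms(4) c(1)])
    also have "\<dots> = dir_deriv (A p c) (dir_deriv (coord c B (snd c p)) ?F) (snd c p)
        + dir_deriv (dir_deriv (A p c) (coord c B) (snd c p)) ?F (snd c p)"
      using dir_deriv_eq[OF has_derivative_deriv_apply[OF open_dom[OF c(1)] F VF_smooth[OF that(2) c(1)] x]]
      by simp
    finally show ?thesis using c by (simp add: coord_chart)
  qed
  show ?thesis
    unfolding *[OF assms(1,2)] *[OF assms(2,1)] vderiv_eq[OF assms(3,4,5) c] lie_bracket_eq[OF assms(5) c]
    using linear_diff[OF smooth_on_linear[OF F x]]
      smooth_on_dir_deriv_commute[OF open_dom[OF c(1)] F x, of "X p c" "Y p c"]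
    by simp
qed

end

section \<open>The fundamental tensor and the Cartan tensor along a vector field\<close>

locale finsler_field = open_submanifold atl \<Omega>
  for atl :: "('m::{t2_space,second_countable_topology}, 'a::euclidean_space) chart set"
    and \<Omega> :: "'m set" +
  fixes A :: "('m \<times> ('m, 'a) tangent) set"
    and L :: "'m \<times> ('m, 'a) tangent \<Rightarrow> real"
    and V :: "('m, 'a) vfield"
  assumes finsler: "pseudo_finsler atl A L"
    and adm: "admissible atl A \<Omega> V"
begin

section \<open>The metric and its vertical derivatives in bundle charts\<close>

abbreviation U :: "('m, 'a) chart \<Rightarrow> ('a \<times> 'a) set" where
  "U c \<equiv> bundle_chart_image atl A c"

abbreviation l :: "('m, 'a) chart \<Rightarrow> 'a \<times> 'a \<Rightarrow> real" where
  "l c \<equiv> L \<circ> inv_bundle_chart atl c"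

lemma open_U: "c \<in> atl \<Longrightarrow> open (U c)"
  using finsler unfolding pseudo_finsler_def by (elim conjE) (erule bspec)

lemma smooth_l: "c \<in> atl \<Longrightarrow> smooth_on (U c) (l c)"
  using finsler unfolding pseudo_finsler_def by (elim conjE) (erule bspec)

lemma V_VF: "V \<in> VF"
  using adm unfolding admissible_def by blast

lemma V_in_U: "c \<in> atl \<Longrightarrow> p \<in> fst c \<Longrightarrow> p \<in> \<Omega> \<Longrightarrow> (snd c p, V p c) \<in> U c"
  using adm inv_bundle_chart_chart[OF VF_tangent[OF V_VF]]
  unfolding admissible_def bundle_chart_image_def by auto

text \<open>Adding tangent vectors at \<open>p\<close> leaves the base point alone, so in the bundle
  chart only the vertical directions \<open>(0, _)\<close> are differentiated.\<close>

lemma fundamental_tensor_coord: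
  assumes "c \<in> atl" "p \<in> fst c" "p \<in> \<Omega>" "u \<in> tangent_space atl p" "v \<in> tangent_space atl p"
  shows "fundamental_tensor L (p, V p) u v
    = 1 / 2 * dir_deriv (0, u c) (dir_deriv (0, v c) (l c)) (snd c p, V p c)"
proof -
  have "L (p, V p + t *\<^sub>T u + s *\<^sub>T v)
    = l c ((snd c p, V p c) + t *\<^sub>R (0, u c) + s *\<^sub>R (0, v c))" for t s
    using inv_bundle_chart_chart[of "V p + t *\<^sub>T u + s *\<^sub>T v" p c] VF_tangent[OF V_VF assms(3)] assms
    by (simp add: tangent_space_add tangent_space_scale) (simp add: tscale_def)
  then have "fundamental_tensor L (p, V p) u v
    = 1 / 2 * deriv (\<lambda>t. deriv (\<lambda>s. l c ((snd c p, V p c) + t *\<^sub>R (0, u c) + s *\<^sub>R (0, v c))) 0) 0"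
    unfolding fundamental_tensor_def fst_conv snd_conv by presburger
  then show ?thesis
    unfolding deriv_line2[OF open_U[OF assms(1)] smooth_l[OF assms(1)] V_in_U[OF assms(1,2,3)]] .
qed

text \<open>As for \<open>fundamental_tensor\<close>, with the first argument innermost. The factor
  1/4 makes the Cartan tensor half the vertical derivative of the fundamental tensor, whence the
  factor 2 in almost compatibility.\<close>

lemma cartan_tensor_coord:
  assumes "c \<in> atl" "p \<in> fst c" "p \<in> \<Omega>" "u \<in> tangent_space atl p" "v \<in> tangent_space atl p"
    "w \<in> tangent_space atl p"
  shows "cartan_tensor L (p, V p) u v w
    = 1 / 4 * dir_deriv (0, w c) (dir_deriv (0, v c) (dir_deriv (0, u c) (l c))) (snd c p, V p c)"
proof -
  have "L (p, V p + r *\<^sub>T u + s *\<^sub>T v + t *\<^sub>T w)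
    = l c ((snd c p, V p c) + r *\<^sub>R (0, u c) + s *\<^sub>R (0, v c) + t *\<^sub>R (0, w c))" for r s t
    using inv_bundle_chart_chart[of "V p + r *\<^sub>T u + s *\<^sub>T v + t *\<^sub>T w" p c] VF_tangent[OF V_VF assms(3)] assms
    by (simp add: tangent_space_add tangent_space_scale) (simp add: tscale_def)
  then have "cartan_tensor L (p, V p) u v w
    = 1 / 4 * deriv (\<lambda>t. deriv (\<lambda>s. deriv (\<lambda>r.
        l c ((snd c p, V p c) + r *\<^sub>R (0, u c) + s *\<^sub>R (0, v c) + t *\<^sub>R (0, w c))) 0) 0) 0"
    unfolding cartan_tensor_def fst_conv snd_conv by presburger
  then show ?thesis
    unfolding deriv_line3[OF open_U[OF assms(1)] smooth_l[OF assms(1)] V_in_U[OF assms(1,2,3)]] .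
qed

abbreviation g :: "('m, 'a) vfield \<Rightarrow> ('m, 'a) vfield \<Rightarrow> 'm \<Rightarrow> real" where
  "g \<equiv> g_field L V"

abbreviation C :: "('m, 'a) vfield \<Rightarrow> ('m, 'a) vfield \<Rightarrow> ('m, 'a) vfield \<Rightarrow> 'm \<Rightarrow> real" where
  "C \<equiv> C_field L V"

lemma g_coord:
  assumes "Y \<in> VF" "Z \<in> VF" "c \<in> atl" "p \<in> fst c" "p \<in> \<Omega>"
  shows "g Y Z p = 1 / 2 * dir_deriv (0, Y p c) (dir_deriv (0, Z p c) (l c)) (snd c p, V p c)"
  unfolding g_field_def
  using fundamental_tensor_coord[OF assms(3-5) VF_tangent[OF assms(1,5)] VF_tangent[OF assms(2,5)]] .

lemma C_coord:
  assumes "Y \<in> VF" "Z \<in> VF" "W \<in> VF" "c \<in> atl" "p \<in> fst c" "p \<in> \<Omega>"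
  shows "C Y Z W p
    = 1 / 4 * dir_deriv (0, W p c) (dir_deriv (0, Z p c) (dir_deriv (0, Y p c) (l c))) (snd c p, V p c)"
  unfolding C_field_def
  using cartan_tensor_coord[OF assms(4-6) VF_tangent[OF assms(1,6)] VF_tangent[OF assms(2,6)]
      VF_tangent[OF assms(3,6)]] .

lemma smooth_vertical: "X \<in> VF \<Longrightarrow> c \<in> atl \<Longrightarrow> smooth_on (dom c) (\<lambda>x. (0 :: 'a, coord c X x))"
  by (rule smooth_on_Pair[OF open_dom smooth_on_const VF_smooth])

lemma smooth_V_section: "c \<in> atl \<Longrightarrow> smooth_on (dom c) (\<lambda>x. (x, coord c V x))"
  by (rule smooth_on_Pair[OF open_dom smooth_on_ident VF_smooth[OF V_VF]])

lemma V_section_image: "c \<in> atl \<Longrightarrow> (\<lambda>x. (x, coord c V x)) ` dom c \<subseteq> U c"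
  by (auto simp: coord_chart intro: V_in_U)

lemma smooth_function_g:
  assumes "Y \<in> VF" "Z \<in> VF"
  shows "smooth_function atl \<Omega> (g Y Z)"
  unfolding smooth_function_def
proof
  fix c assume c: "c \<in> atl"
  have "smooth_on (dom c) (\<lambda>x. 1 / 2 * dir_deriv (0, coord c Y x) (dir_deriv (0, coord c Z x) (l c)) (x, coord c V x))"
    by (rule smooth_on_bounded_linear_compose[OF open_dom[OF c] bounded_linear_mult_right
          smooth_on_dir_deriv2_apply[OF open_dom[OF c] open_U[OF c] smooth_l[OF c] smooth_V_section[OF c]
            V_section_image[OF c] smooth_vertical[OF assms(1) c] smooth_vertical[OF assms(2) c]]])
  then show "smooth_on (dom c) (g Y Z \<circ> inv_chart c)"
    by (rule smooth_on_cong[OF open_dom[OF c], rotated])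
      (use c in \<open>auto simp: coord_chart inv_chart_chart g_coord[OF assms c]\<close>)
qed

lemma smooth_function_C:
  assumes "Y \<in> VF" "Z \<in> VF" "W \<in> VF"
  shows "smooth_function atl \<Omega> (C Y Z W)"
  unfolding smooth_function_def
proof
  fix c assume c: "c \<in> atl"
  have "smooth_on (dom c) (\<lambda>x. 1 / 4 * dir_deriv (0, coord c W x)
      (dir_deriv (0, coord c Z x) (dir_deriv (0, coord c Y x) (l c))) (x, coord c V x))"
    by (rule smooth_on_bounded_linear_compose[OF open_dom[OF c] bounded_linear_mult_right
          smooth_on_dir_deriv3_apply[OF open_dom[OF c] open_U[OF c] smooth_l[OF c] smooth_V_section[OF c]
            V_section_image[OF c] smooth_vertical[OF assms(3) c] smooth_vertical[OF assms(2) c]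
            smooth_vertical[OF assms(1) c]]])
  then show "smooth_on (dom c) (C Y Z W \<circ> inv_chart c)"
    by (rule smooth_on_cong[OF open_dom[OF c], rotated])
      (use c in \<open>auto simp: coord_chart inv_chart_chart C_coord[OF assms c]\<close>)
qed

lemma g_commute:
  assumes "Y \<in> VF" "Z \<in> VF" "p \<in> \<Omega>"
  shows "g Y Z p = g Z Y p"
proof -
  obtain c where c: "c \<in> atl" "p \<in> fst c" using ex_chart by blast
  show ?thesis
    unfolding g_coord[OF assms(1,2) c assms(3)] g_coord[OF assms(2,1) c assms(3)]
    using smooth_on_dir_deriv_commute[OF open_U[OF c(1)] smooth_l[OF c(1)] V_in_U[OF c assms(3)]] by simp
qed

text \<open>The first slot is the outer derivative, so linearity is that of a Frechet derivative.
  The form with differences is the one that matches the shape of \<open>curvature\<close>.\<close>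

lemma g_diff_left:
  assumes "X \<in> VF" "Y \<in> VF" "Z \<in> VF" "p \<in> \<Omega>"
  shows "g (X - Y) Z p = g X Z p - g Y Z p"
proof -
  obtain c where c: "c \<in> atl" "p \<in> fst c" using ex_chart by blast
  have "linear (\<lambda>w. dir_deriv w (dir_deriv (0, Z p c) (l c)) (snd c p, V p c))"
    by (rule smooth_on_linear[OF smooth_on_dir_deriv[OF smooth_l[OF c(1)]] V_in_U[OF c assms(4)]])
  from linear_diff[OF this, of "(0, X p c)" "(0, Y p c)"] show ?thesis
    unfolding g_coord[OF assms(1,3) c assms(4)] g_coord[OF assms(2,3) c assms(4)]
      g_coord[OF VF_diff[OF assms(1,2)] assms(3) c assms(4)]
    by (simp add: algebra_simps)
qed

text \<open>Unlike for \<open>g\<close>, the first slot is the innermost derivative, so linearity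
  rests on commuting derivatives.\<close>

lemma C_diff_left:
  assumes "X \<in> VF" "Y \<in> VF" "Z \<in> VF" "W \<in> VF" "p \<in> \<Omega>"
  shows "C (X - Y) Z W p = C X Z W p - C Y Z W p"
proof -
  obtain c where c: "c \<in> atl" "p \<in> fst c" using ex_chart by blast
  have "linear (\<lambda>w. dir_deriv (0, W p c) (dir_deriv (0, Z p c) (dir_deriv w (l c))) (snd c p, V p c))"
    by (rule linear_dir_deriv3[OF open_U[OF c(1)] smooth_l[OF c(1)] V_in_U[OF c assms(5)]])
  from linear_diff[OF this, of "(0, X p c)" "(0, Y p c)"] show ?thesis
    unfolding C_coord[OF assms(1,3,4) c assms(5)] C_coord[OF assms(2,3,4) c assms(5)]
      C_coord[OF VF_diff[OF assms(1,2)] assms(3,4) c assms(5)]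
    by (simp add: algebra_simps)
qed

end

section \<open>The curvature of the connection\<close>

locale finsler_connection = finsler_field atl \<Omega> A L V
  for atl :: "('m::{t2_space,second_countable_topology}, 'a::euclidean_space) chart set"
    and \<Omega> :: "'m set"
    and A :: "('m \<times> ('m, 'a) tangent) set"
    and L :: "'m \<times> ('m, 'a) tangent \<Rightarrow> real"
    and V :: "('m, 'a) vfield" +
  fixes nabla :: "('m, 'a) vfield \<Rightarrow> ('m, 'a) vfield \<Rightarrow> ('m, 'a) vfield"
  assumes is_nabla: "is_nabla_V atl L \<Omega> V nabla"
begin

abbreviation R :: "('m, 'a) vfield \<Rightarrow> ('m, 'a) vfield \<Rightarrow> ('m, 'a) vfield \<Rightarrow> ('m, 'a) vfield" where
  "R \<equiv> curvature atl \<Omega> nabla"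

abbreviation B :: "('m, 'a) vfield \<Rightarrow> ('m, 'a) vfield \<Rightarrow> ('m, 'a) vfield \<Rightarrow> ('m, 'a) vfield \<Rightarrow> 'm \<Rightarrow> real" where
  "B \<equiv> B_field atl L \<Omega> V nabla"

abbreviation lie :: "('m, 'a) vfield \<Rightarrow> ('m, 'a) vfield \<Rightarrow> ('m, 'a) vfield" where
  "lie \<equiv> lie_bracket atl \<Omega>"

section \<open>Formal rules of the connection\<close>

lemma affine: "affine_connection atl \<Omega> nabla"
  using is_nabla unfolding is_nabla_V_def by (elim conjE)

lemma nabla_VF: "X \<in> VF \<Longrightarrow> Y \<in> VF \<Longrightarrow> nabla X Y \<in> VF"
  using affine unfolding affine_connection_def by (elim conjE) (drule (1) bspec, erule (1) bspec)

lemma nabla_add_left: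
  "X \<in> VF \<Longrightarrow> X' \<in> VF \<Longrightarrow> Y \<in> VF \<Longrightarrow> nabla (X + X') Y = nabla X Y + nabla X' Y"
  using affine unfolding affine_connection_def by (elim conjE) simp

lemma nabla_add_right:
  "X \<in> VF \<Longrightarrow> Y \<in> VF \<Longrightarrow> Y' \<in> VF \<Longrightarrow> nabla X (Y + Y') = nabla X Y + nabla X Y'"
  using affine unfolding affine_connection_def by (elim conjE) simp

lemma torsion_free: "X \<in> VF \<Longrightarrow> Y \<in> VF \<Longrightarrow> nabla X Y - nabla Y X = lie X Y"
  using is_nabla unfolding is_nabla_V_def by (elim conjE) simp

lemma almost_compatible:
  assumes "X \<in> VF" "Y \<in> VF" "Z \<in> VF" "p \<in> \<Omega>"
  shows "vderiv atl X (g Y Z) p = g (nabla X Y) Z p + g Y (nabla X Z) p + 2 * C (nabla X V) Y Z p"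
  using is_nabla assms unfolding is_nabla_V_def by (elim conjE) simp

text \<open>Torsion-freeness exhibits the bracket as a difference of two vector fields, which
  replaces a check of its transformation law.\<close>

lemma lie_VF: "X \<in> VF \<Longrightarrow> Y \<in> VF \<Longrightarrow> lie X Y \<in> VF"
  using VF_diff[OF nabla_VF nabla_VF] torsion_free by metis

lemma nabla_diff_right:
  assumes "X \<in> VF" "Y \<in> VF" "Y' \<in> VF"
  shows "nabla X (Y - Y') = nabla X Y - nabla X Y'"
  using nabla_add_right[OF assms(1) VF_diff[OF assms(2,3)] assms(3)] by (simp add: algebra_simps)

lemma nabla_uminus_left:
  assumes "X \<in> VF" "Y \<in> VF"
  shows "nabla (- X) Y = - nabla X Y"
proof -
  have "nabla 0 Y = 0"
    using nabla_add_left[OF VF_zero VF_zero assms(2)] by simp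
  then show ?thesis
    using nabla_add_left[OF assms(1) VF_uminus[OF assms(1)] assms(2)] by (simp add: add_eq_0_iff)
qed

section \<open>Symmetries of the curvature\<close>

lemma curvature_VF: "X \<in> VF \<Longrightarrow> Y \<in> VF \<Longrightarrow> Z \<in> VF \<Longrightarrow> R X Y Z \<in> VF"
  unfolding curvature_def by (intro VF_diff nabla_VF lie_VF)

lemma curvature_antisym:
  assumes "X \<in> VF" "Y \<in> VF" "Z \<in> VF"
  shows "R X Y Z = - R Y X Z"
  unfolding curvature_def lie_bracket_antisym[of X Y]
    nabla_uminus_left[OF lie_VF[OF assms(2,1)] assms(3)]
  by (simp add: algebra_simps)

lemma first_bianchi:
  assumes "X \<in> VF" "Y \<in> VF" "Z \<in> VF"
  shows "R X Y Z + R Y Z X + R Z X Y = 0"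
proof -
  \<comment> \<open>Torsion-freeness twice: once to exchange \<open>Q\<close> and \<open>S\<close>,
    once to exchange \<open>P\<close> with the bracket that this creates. In the cyclic sum the
    terms \<open>nabla (lie Q S) P\<close> cancel those of the curvature, and only nested brackets
    survive.\<close>
  have *: "nabla P (nabla Q S) = nabla P (nabla S Q) + nabla (lie Q S) P + lie P (lie Q S)"
    if "P \<in> VF" "Q \<in> VF" "S \<in> VF" for P Q S
    using nabla_diff_right[OF that(1) nabla_VF[OF that(2,3)] nabla_VF[OF that(3,2)]]
      torsion_free[OF that(2,3)] torsion_free[OF that(1) lie_VF[OF that(2,3)]]
    by (simp add: algebra_simps)
  show ?thesis
    unfolding curvature_def *[OF assms(1,2,3)] *[OF assms(2,3,1)] *[OF assms(3,1,2)]
    using jacobi_identity[OF assms] by (simp add: algebra_simps)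
qed

text \<open>Almost compatibility differentiated once more. The two \<open>g\<close> terms are again
  of the form it governs; the \<open>C\<close> term is left for \<open>nabla_C\<close> to
  absorb.\<close>

lemma vderiv_vderiv_g:
  assumes "X \<in> VF" "Y \<in> VF" "Z \<in> VF" "W \<in> VF" "p \<in> \<Omega>"
  shows "vderiv atl X (vderiv atl Y (g Z W)) p =
    vderiv atl X (g (nabla Y Z) W) p + vderiv atl X (g Z (nabla Y W)) p
    + 2 * vderiv atl X (C (nabla Y V) Z W) p"
proof -
  note n = nabla_VF[OF assms(2,3)] nabla_VF[OF assms(2,4)] nabla_VF[OF assms(2) V_VF]
  note s = smooth_function_g[OF n(1) assms(4)] smooth_function_g[OF assms(3) n(2)]
    smooth_function_C[OF n(3) assms(3,4)]
  have "vderiv atl X (vderiv atl Y (g Z W)) p =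
    vderiv atl X (\<lambda>q. g (nabla Y Z) W q + g Z (nabla Y W) q + 2 * C (nabla Y V) Z W q) p"
    by (rule vderiv_cong[OF assms(5)]) (rule almost_compatible[OF assms(2-4)])
  then show ?thesis
    using vderiv_add[OF assms(1) smooth_function_add[OF s(1,2)] smooth_function_cmult[OF s(3)] assms(5)]
      vderiv_add[OF assms(1) s(1,2) assms(5)] vderiv_cmult[OF assms(1) s(3) assms(5)] by simp
qed

lemma curvature_skew_defect:
  assumes "X \<in> VF" "Y \<in> VF" "Z \<in> VF" "W \<in> VF" "p \<in> \<Omega>"
  shows "g (R X Y Z) W p + g (R X Y W) Z p = 2 * B X Y Z W p"
proof -
  note n = nabla_VF
  note lXY = lie_VF[OF assms(1,2)]
  \<comment> \<open>Grouped so that the two mixed \<open>g\<close> terms and the four mixed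
    \<open>C\<close> terms are visibly symmetric in \<open>P\<close> and \<open>Q\<close>: they drop
    out when the roles of \<open>X\<close> and \<open>Y\<close> are exchanged and the results
    subtracted. The last two of the four come from the definition of \<open>nabla_C\<close>.\<close>
  have expand: "vderiv atl P (vderiv atl Q (g Z W)) p =
      g (nabla P (nabla Q Z)) W p + g (nabla Q Z) (nabla P W) p
      + g (nabla P Z) (nabla Q W) p + g Z (nabla P (nabla Q W)) p
      + 2 * (C (nabla P V) (nabla Q Z) W p + C (nabla P V) Z (nabla Q W) p
        + C (nabla Q V) (nabla P Z) W p + C (nabla Q V) Z (nabla P W) p)
      + 2 * (nabla_C atl L V nabla P (nabla Q V) Z W p + C (nabla P (nabla Q V)) Z W p)"
    if "P \<in> VF" "Q \<in> VF" for P Q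
    using vderiv_vderiv_g[OF that assms(3-5)]
      almost_compatible[OF that(1) n[OF that(2) assms(3)] assms(4,5)]
      almost_compatible[OF that(1) assms(3) n[OF that(2) assms(4)] assms(5)]
    by (simp add: nabla_C_def)
  have gR: "g (R X Y S) T p = g (nabla X (nabla Y S)) T p - g (nabla Y (nabla X S)) T p - g (nabla (lie X Y) S) T p"
    if "S \<in> VF" "T \<in> VF" for S T
    unfolding curvature_def using assms that by (simp add: g_diff_left VF_diff n lXY)
  have CR: "C (R Y X V) Z W p = C (nabla Y (nabla X V)) Z W p - C (nabla X (nabla Y V)) Z W p + C (nabla (lie X Y) V) Z W p"
  proof -
    \<comment> \<open>The plus sign before the bracket term comes from
      \<open>lie Y X = - lie X Y\<close>; nesting the differences lets \<open>C_diff_left\<close>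
      apply twice. The bracket term matches the \<open>C\<close> term in almost compatibility along
      \<open>lie X Y\<close>.\<close>
    have "R Y X V = nabla Y (nabla X V) - (nabla X (nabla Y V) - nabla (lie X Y) V)"
      unfolding curvature_def lie_bracket_antisym[of Y X] nabla_uminus_left[OF lXY V_VF]
      by (simp add: algebra_simps)
    then show ?thesis using assms V_VF by (simp add: C_diff_left VF_diff n lXY)
  qed
  have "vderiv atl (lie X Y) (g Z W) p
      = vderiv atl X (vderiv atl Y (g Z W)) p - vderiv atl Y (vderiv atl X (g Z W)) p"
    by (rule vderiv_lie_bracket[OF assms(1,2) lXY smooth_function_g[OF assms(3,4)] assms(5)])
  then show ?thesis
    unfolding expand[OF assms(1,2)] expand[OF assms(2,1)] almost_compatible[OF lXY assms(3-5)]
      gR[OF assms(3,4)] gR[OF assms(4,3)] B_field_def CR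
    using g_commute[OF n[OF assms(1) n[OF assms(2,4)]] assms(3,5)]
      g_commute[OF n[OF assms(2) n[OF assms(1,4)]] assms(3,5)]
      g_commute[OF n[OF lXY assms(4)] assms(3,5)]
    by (simp add: algebra_simps)
qed

lemma g_curvature_antisym:
  assumes "X \<in> VF" "Y \<in> VF" "Z \<in> VF" "W \<in> VF" "p \<in> \<Omega>"
  shows "g (R X Y Z) W p = - g (R Y X Z) W p"
proof -
  \<comment> \<open>The negative is written with differences only, so that
    \<open>g_diff_left\<close> carries it through \<open>g\<close>.\<close>
  have "R X Y Z = (R Y X Z - R Y X Z) - R Y X Z" using curvature_antisym[OF assms(1-3)] by simp
  then show ?thesis
    using g_diff_left[OF VF_diff, OF curvature_VF curvature_VF curvature_VF, OF assms(2,1,3) assms(2,1,3) assms(2,1,3) assms(4,5)]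
      g_diff_left[OF curvature_VF curvature_VF, OF assms(2,1,3) assms(2,1,3) assms(4,5)]
    by simp
qed

lemma g_first_bianchi:
  assumes "X \<in> VF" "Y \<in> VF" "Z \<in> VF" "W \<in> VF" "p \<in> \<Omega>"
  shows "g (R X Y Z) W p + g (R Y Z X) W p + g (R Z X Y) W p = 0"
proof -
  \<comment> \<open>The cyclic identity is solved for one term and the sign of
    \<open>R Y Z X\<close> is absorbed by antisymmetry, which again leaves a single difference for
    \<open>g_diff_left\<close>.\<close>
  have "R X Y Z = (R X Y Z + R Y Z X + R Z X Y) - R Y Z X - R Z X Y" by simp
  then have "R X Y Z = R Z Y X - R Z X Y"
    unfolding first_bianchi[OF assms(1-3)] using curvature_antisym[OF assms(3,2,1)] by simp
  then have "g (R X Y Z) W p = g (R Z Y X) W p - g (R Z X Y) W p"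
    using g_diff_left[OF curvature_VF curvature_VF, OF assms(3,2,1) assms(3,1,2) assms(4,5)] by simp
  then show ?thesis using g_curvature_antisym[OF assms(2,3,1,4,5)] by simp
qed

text \<open>
  As for the Riemannian pair symmetry, combine the four cyclic identities; the terms \<open>B\<close> collect
  the failure of skew-symmetry in the last two slots.
\<close>

lemma curvature_pair_defect:
  assumes "X \<in> VF" "Y \<in> VF" "Z \<in> VF" "W \<in> VF" "p \<in> \<Omega>"
  shows "g (R X Y Z) W p - g (R Z W X) Y p =
       B Z Y X W p + B X Z Y W p + B W X Z Y p +
       B Y W Z X p + B W Z X Y p + B X Y Z W p"
  using g_first_bianchi[OF assms(1,2,3,4,5)] g_first_bianchi[OF assms(2,3,4,1,5)]
    g_first_bianchi[OF assms(3,4,1,2,5)] g_first_bianchi[OF assms(4,1,2,3,5)]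
    g_curvature_antisym[OF assms(1,2,3,4,5)] g_curvature_antisym[OF assms(1,2,4,3,5)]
    g_curvature_antisym[OF assms(1,3,2,4,5)] g_curvature_antisym[OF assms(1,3,4,2,5)]
    g_curvature_antisym[OF assms(1,4,2,3,5)] g_curvature_antisym[OF assms(1,4,3,2,5)]
    g_curvature_antisym[OF assms(2,3,1,4,5)] g_curvature_antisym[OF assms(2,3,4,1,5)]
    g_curvature_antisym[OF assms(2,4,1,3,5)] g_curvature_antisym[OF assms(2,4,3,1,5)]
    g_curvature_antisym[OF assms(3,4,1,2,5)] g_curvature_antisym[OF assms(3,4,2,1,5)]
    curvature_skew_defect[OF assms(3,2,1,4,5)] curvature_skew_defect[OF assms(1,3,2,4,5)]
    curvature_skew_defect[OF assms(4,1,3,2,5)] curvature_skew_defect[OF assms(2,4,3,1,5)]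
    curvature_skew_defect[OF assms(4,3,1,2,5)] curvature_skew_defect[OF assms(1,2,3,4,5)]
  by linarith

end

theorem proposition3p1:
  fixes atl :: "('m::{t2_space,second_countable_topology}, 'a::euclidean_space) chart set"
    and A :: "('m \<times> ('m, 'a) tangent) set"
    and L :: "'m \<times> ('m, 'a) tangent \<Rightarrow> real"
    and \<Omega> :: "'m set"
    and V X Y Z W :: "('m, 'a) vfield"
    and nabla :: "('m, 'a) vfield \<Rightarrow> ('m, 'a) vfield \<Rightarrow> ('m, 'a) vfield"
    and R :: "('m, 'a) vfield \<Rightarrow> ('m, 'a) vfield \<Rightarrow> ('m, 'a) vfield \<Rightarrow> ('m, 'a) vfield"
    and g :: "('m, 'a) vfield \<Rightarrow> ('m, 'a) vfield \<Rightarrow> 'm \<Rightarrow> real"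
    and B :: "('m, 'a) vfield \<Rightarrow> ('m, 'a) vfield \<Rightarrow> ('m, 'a) vfield \<Rightarrow> ('m, 'a) vfield \<Rightarrow> 'm \<Rightarrow> real"
  defines "R \<equiv> curvature atl \<Omega> nabla"
    and "g \<equiv> g_field L V"
    and "B \<equiv> B_field atl L \<Omega> V nabla"
  assumes "smooth_atlas atl"
    and "pseudo_finsler atl A L"
    and "open \<Omega>"
    and "admissible atl A \<Omega> V"
    and "is_nabla_V atl L \<Omega> V nabla"
    and "X \<in> vector_fields atl \<Omega>" "Y \<in> vector_fields atl \<Omega>"
        "Z \<in> vector_fields atl \<Omega>" "W \<in> vector_fields atl \<Omega>"
  shows "R X Y Z = - R Y X Z \<and>
    (\<forall>p\<in>\<Omega>. g (R X Y Z) W p + g (R X Y W) Z p = 2 * B X Y Z W p) \<and>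
    R X Y Z + R Y Z X + R Z X Y = 0 \<and>
    (\<forall>p\<in>\<Omega>. g (R X Y Z) W p - g (R Z W X) Y p =
       B Z Y X W p + B X Z Y W p + B W X Z Y p +
       B Y W Z X p + B W Z X Y p + B X Y Z W p)"
proof -
  interpret finsler_connection atl \<Omega> A L V nabla
    using assms(4-8) by unfold_locales
  show ?thesis
    unfolding R_def g_def B_def
    using curvature_antisym[OF assms(9-11)] curvature_skew_defect[OF assms(9-12)]
      first_bianchi[OF assms(9-11)] curvature_pair_defect[OF assms(9-12)]
    by (intro conjI ballI)
qed

end
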